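(* Let $|A|<1$ and $M>1$. Then $(\mathcal{K}_{A,M})^{lc,\Lambda_A}=\bar{\mathcal{U}}_{A,M}$.
   Context: $\mathbb{R}^2\simeq\mathbb{C}$ with $\mathbf{i}=(0,1)$ the imaginary unit; juxtaposed products of elements of $\mathbb{R}^2$ are complex products, $\cdot$ is the Euclidean scalar product. $\mathcal{K}=\{z=(\theta,\mathbf{u},\mathbf{m})\in[-1,1]\times\mathbb{R}^2\times\mathbb{R}^2:|\theta|=1,\ \mathbf{m}=\theta\mathbf{u}\}$; for $M>1$, with $M_{\pm A}=\sqrt{\frac{M^2\pm A}{1\pm A}}$, $$\mathcal{K}_{A,M}=\{z\in\mathcal{K}:|2\mathbf{u}+\theta\mathbf{i}|\le M_{\theta A}\}=\{z\in\mathcal{K}:4\mathbf{u}\cdot(\mathbf{u}+A\mathbf{m}+\theta\mathbf{i}+A\mathbf{i})\le M^2-1\}.$$ Wave cone: $\Lambda_A=\varLambda_0\cup\varLambda_1\subset\mathbb{R}^5$, $\varLambda_0=\{\bar z:\bar\theta=0,\ \bar{\mathbf{u}}=-A\bar{\mathbf{m}}\}$, $\varLambda_1=\{\bar z:\bar\theta\neq0,\ \bar{\mathbf{u}}=\bar\omega(A\bar{\mathbf{m}}+\bar\theta\mathbf{i})\text{ for some }\bar\omega\text{ with }|2\bar\omega+1|=1\}$. For a set $K$ and a cone $\Lambda$ in $\mathbb{R}^N$: $K^{1,\Lambda}=\{\tfrac{1+s}{2}z_1+\tfrac{1-s}{2}z_2:s\in[-1,1],\ z_1,z_2\in K,\ z_1-z_2\in\Lambda\}$,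 $K^{n,\Lambda}=(K^{n-1,\Lambda})^{1,\Lambda}$ for $n\ge2$, and $K^{lc,\Lambda}=\bigcup_{n\ge1}K^{n,\Lambda}$. $\bar{\mathcal{U}}_{A,M}$ is the closure of the open set $\mathcal{U}_{A,M}$ of $z=(\theta,\mathbf{u},\mathbf{m})\in[-1,1]\times\mathbb{R}^2\times\mathbb{R}^2$ satisfying $$\begin{aligned} |2(1-\theta A)(\mathbf{m}-\theta\mathbf{u})+(1-\theta^2)(A\mathbf{u}+\mathbf{i})|&<(1-\theta^2)|A\mathbf{u}+\mathbf{i}|,\\ 4\mathbf{u}\cdot(\mathbf{u}+A\mathbf{m}+\theta\mathbf{i}+A\mathbf{i})&<M^2-1,\\ |2(\mathbf{m}-\mathbf{u})+(1-\theta)\mathbf{i}|&<M_{-A}(1-\theta),\\ |2(\mathbf{m}+\mathbf{u})+(1+\theta)\mathbf{i}|&<M_{+A}(1+\theta). \end{aligned}$$ *)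

theory Defs
  imports "HOL-Analysis.Analysis"
begin

text \<open>
  The plane is identified with the type \<^typ>\<open>complex\<close>: juxtaposition of plane vectors is complex
  multiplication, and the Euclidean scalar product is \<^const>\<open>inner\<close> on \<^typ>\<open>complex\<close>.
\<close>

type_synonym state = "real \<times> complex \<times> complex"


definition lam_step :: "'a::real_vector set \<Rightarrow> 'a set \<Rightarrow> 'a set" where
  "lam_step \<Lambda> K =
     {((1 + s) / 2) *\<^sub>R z1 + ((1 - s) / 2) *\<^sub>R z2 | s z1 z2.
        s \<in> {-1..1} \<and> z1 \<in> K \<and> z2 \<in> K \<and> z1 - z2 \<in> \<Lambda>}"

definition lam_iter :: "nat \<Rightarrow> 'a::real_vector set \<Rightarrow> 'a set \<Rightarrow> 'a set" where
  "lam_iter n \<Lambda> K = (lam_step \<Lambda> ^^ n) K"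

definition lam_hull :: "'a::real_vector set \<Rightarrow> 'a set \<Rightarrow> 'a set" where
  "lam_hull \<Lambda> K = (\<Union>n\<in>{1..}. lam_iter n \<Lambda> K)"


text \<open>
  The constants \<open>M\<^sub>+\<^sub>A\<close>, \<open>M\<^sub>-\<^sub>A\<close> and (for \<open>\<bar>\<theta>\<bar> = 1\<close>) \<open>M\<^sub>\<theta>\<^sub>A\<close> are the values of the following
  function of the signed parameter \<open>B\<close> at \<open>A\<close>, \<open>-A\<close> and \<open>\<theta> * A\<close>.
\<close>

definition bound_const :: "real \<Rightarrow> real \<Rightarrow> real" where
  "bound_const M B = sqrt ((M\<^sup>2 + B) / (1 + B))"

definition constraint_set :: "state set" where
  "constraint_set = {(\<theta>, u, m). \<theta> \<in> {-1..1} \<and> \<bar>\<theta>\<bar> = 1 \<and> m = \<theta> *\<^sub>R u}"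

definition bounded_constraint_set :: "real \<Rightarrow> real \<Rightarrow> state set" where
  "bounded_constraint_set A M =
     {(\<theta>, u, m) \<in> constraint_set. cmod (2 * u + \<theta> *\<^sub>R \<i>) \<le> bound_const M (\<theta> * A)}"

definition wave_cone0 :: "real \<Rightarrow> state set" where
  "wave_cone0 A = {(\<theta>, u, m). \<theta> = 0 \<and> u = - (A *\<^sub>R m)}"

definition wave_cone1 :: "real \<Rightarrow> state set" where
  "wave_cone1 A =
     {(\<theta>, u, m). \<theta> \<noteq> 0 \<and> (\<exists>\<omega>. cmod (2 * \<omega> + 1) = 1 \<and> u = \<omega> * (A *\<^sub>R m + \<theta> *\<^sub>R \<i>))}"

definition wave_cone :: "real \<Rightarrow> state set" where
  "wave_cone A = wave_cone0 A \<union> wave_cone1 A"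

definition hull_interior :: "real \<Rightarrow> real \<Rightarrow> state set" where
  "hull_interior A M =
     {(\<theta>, u, m). \<theta> \<in> {-1..1} \<and>
        cmod ((2 * (1 - \<theta> * A)) *\<^sub>R (m - \<theta> *\<^sub>R u) + (1 - \<theta>\<^sup>2) *\<^sub>R (A *\<^sub>R u + \<i>))
          < (1 - \<theta>\<^sup>2) * cmod (A *\<^sub>R u + \<i>) \<and>
        4 * (u \<bullet> (u + A *\<^sub>R m + \<theta> *\<^sub>R \<i> + A *\<^sub>R \<i>)) < M\<^sup>2 - 1 \<and>
        cmod (2 * (m - u) + (1 - \<theta>) *\<^sub>R \<i>) < bound_const M (- A) * (1 - \<theta>) \<and>
        cmod (2 * (m + u) + (1 + \<theta>) *\<^sub>R \<i>) < bound_const M A * (1 + \<theta>)}"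

lemma bounded_constraint_set_alt:
  assumes "\<bar>A\<bar> < 1" "M > 1"
  shows "bounded_constraint_set A M =
    {(\<theta>, u, m) \<in> constraint_set. 4 * (u \<bullet> (u + A *\<^sub>R m + \<theta> *\<^sub>R \<i> + A *\<^sub>R \<i>)) \<le> M\<^sup>2 - 1}"
proof -
  have key: "cmod (2 * u + \<theta> *\<^sub>R \<i>) \<le> bound_const M (\<theta> * A) \<longleftrightarrow>
      4 * (u \<bullet> (u + A *\<^sub>R m + \<theta> *\<^sub>R \<i> + A *\<^sub>R \<i>)) \<le> M\<^sup>2 - 1"
    if z: "\<bar>\<theta>\<bar> = 1" "m = \<theta> *\<^sub>R u" for \<theta> :: real and u m :: complex
  proof -
    have pos: "1 + \<theta> * A > 0" and tt: "\<theta> * \<theta> = 1"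
      using z assms by (auto simp: abs_if split: if_splits)
    have "cmod (2 * u + \<theta> *\<^sub>R \<i>) \<le> bound_const M (\<theta> * A) \<longleftrightarrow>
        (cmod (2 * u + \<theta> *\<^sub>R \<i>))\<^sup>2 \<le> (M\<^sup>2 + \<theta> * A) / (1 + \<theta> * A)"
      unfolding bound_const_def using real_sqrt_le_iff[of "(cmod (2 * u + \<theta> *\<^sub>R \<i>))\<^sup>2"] by simp
    also have "\<dots> \<longleftrightarrow> (cmod (2 * u + \<theta> *\<^sub>R \<i>))\<^sup>2 * (1 + \<theta> * A) \<le> M\<^sup>2 + \<theta> * A"
      using pos by (simp add: pos_le_divide_eq)
    also have "(cmod (2 * u + \<theta> *\<^sub>R \<i>))\<^sup>2 = 4 * ((Re u)\<^sup>2 + (Im u)\<^sup>2 + \<theta> * Im u) + 1"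
      unfolding cmod_power2 using tt by (simp add: power2_eq_square algebra_simps)
    also have "(4 * ((Re u)\<^sup>2 + (Im u)\<^sup>2 + \<theta> * Im u) + 1) * (1 + \<theta> * A) \<le> M\<^sup>2 + \<theta> * A \<longleftrightarrow>
        4 * (u \<bullet> (u + A *\<^sub>R m + \<theta> *\<^sub>R \<i> + A *\<^sub>R \<i>)) \<le> M\<^sup>2 - 1"
    proof -
      have "(4 * ((Re u)\<^sup>2 + (Im u)\<^sup>2 + \<theta> * Im u) + 1) * (1 + \<theta> * A) - \<theta> * A - 1
        = 4 * (u \<bullet> (u + A *\<^sub>R m + \<theta> *\<^sub>R \<i> + A *\<^sub>R \<i>)) + 4 * (\<theta> * \<theta> - 1) * A * Im u"
        unfolding z(2) by (simp add: inner_complex_def power2_eq_square algebra_simps)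
      then have "(4 * ((Re u)\<^sup>2 + (Im u)\<^sup>2 + \<theta> * Im u) + 1) * (1 + \<theta> * A) - \<theta> * A - 1
        = 4 * (u \<bullet> (u + A *\<^sub>R m + \<theta> *\<^sub>R \<i> + A *\<^sub>R \<i>))"
        unfolding tt by simp
      then show ?thesis by linarith
    qed
    finally show ?thesis .
  qed
  show ?thesis
    unfolding bounded_constraint_set_def using key by (auto simp: constraint_set_def)
qed

end

theory Submission
  imports Defs
begin

text \<open>
  A state with \<open>\<bar>\<theta>\<bar> < 1\<close> is the barycentre, with weights \<open>l = (1 + \<theta>) / 2\<close> and \<open>1 - l\<close>, of one state
  with \<open>\<theta> = 1\<close> and one with \<open>\<theta> = -1\<close>. Let \<open>p\<close> and \<open>q\<close> be the values of \<open>2u + \<theta>\<i>\<close> at these two.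
  The four conditions of the hull then read \<open>gap > 0\<close>, \<open>flux < N\<close>, \<open>excess (- A) q < N\<close> and
  \<open>excess A p < N\<close>, where \<open>N = M\<^sup>2 - 1\<close> and
  \<open>flux = l * excess A p + (1 - l) * excess (- A) q + l * (1 - l) * gap A p q\<close>;
  moreover \<open>gap A p q = 0\<close> means exactly that the two states are connected by the wave cone.
  As a quadratic function whose principal part vanishes on the cone, \<open>flux\<close> is affine along cone
  segments, whereas \<open>l * excess A p\<close> and \<open>(1 - l) * excess (- A) q\<close> are convex. So
  \<open>l * (1 - l) * gap\<close> is concave along cone segments, and the closed hull is stable under lamination.

  Conversely, three laminations reach every point of the closed hull. A segment of the cone with
  \<open>\<theta>\<close> and \<open>flux\<close> constant leads to points where \<open>gap = 0\<close> (a single lamination) or, up to a reflection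
  that exchanges \<open>p\<close> and \<open>q\<close>, where \<open>excess A p = N\<close>. In the latter case choose \<open>q1\<close> with
  \<open>excess (- A) q1 = N\<close> and \<open>gap A p q1 = 0\<close> and keep \<open>p\<close> fixed: a cone segment through the point
  joins a state over \<open>(p, q1)\<close>, where \<open>flux = N\<close>, to a state with \<open>\<theta> = -1\<close>. Since \<open>flux\<close> is affine
  and at most \<open>N\<close> at the given point, it is at most \<open>N\<close> at the other end, which is therefore admissible.
\<close>

section \<open>Two-phase coordinates\<close>

definition pt :: "real \<Rightarrow> complex \<Rightarrow> complex \<Rightarrow> state" where
  "pt l p q = (2 * l - 1, (1 / 2) *\<^sub>R (l *\<^sub>R (p - \<i>) + (1 - l) *\<^sub>R (q + \<i>)),
     (1 / 2) *\<^sub>R (l *\<^sub>R (p - \<i>) - (1 - l) *\<^sub>R (q + \<i>)))"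

text \<open>The value of \<open>flux\<close> at a pure phase, for \<open>B = A\<close> or
  \<open>B = - A\<close>. For \<open>- 1 < B\<close> the factor \<open>1 + B\<close> turns the bound
  \<open>cmod p \<le> bound_const M B\<close> into one with right-hand side
  \<open>M\<^sup>2 - 1\<close>, common to both phases.\<close>

definition excess :: "real \<Rightarrow> complex \<Rightarrow> real" where
  "excess B p = (1 + B) * ((cmod p)\<^sup>2 - 1)"

text \<open>Equal to -4 times \<open>cone_form\<close> of the difference
  \<open>pt 1 p q - pt 0 p q\<close>.\<close>

definition gap :: "real \<Rightarrow> complex \<Rightarrow> complex \<Rightarrow> real" where
  "gap A p q = 4 + 2 * A * (Im p + Im q) + 2 * (p \<bullet> q) - (1 + A) * (cmod p)\<^sup>2 - (1 - A) * (cmod q)\<^sup>2"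

definition flux :: "real \<Rightarrow> state \<Rightarrow> real" where
  "flux A = (\<lambda>(\<theta>, u, m). 4 * (u \<bullet> (u + A *\<^sub>R m + \<theta> *\<^sub>R \<i> + A *\<^sub>R \<i>)))"

text \<open>A quarter of the quadratic part of \<open>flux\<close>, whose remaining term
  \<open>4 * A * Im u\<close> is linear.\<close>

definition cone_form :: "real \<Rightarrow> state \<Rightarrow> real" where
  "cone_form A = (\<lambda>(\<theta>, u, m). u \<bullet> (u + A *\<^sub>R m + \<theta> *\<^sub>R \<i>))"

text \<open>
  The factor \<open>l * (1 - l)\<close> drops the gap condition when \<open>\<bar>\<theta>\<bar> = 1\<close>, where \<open>pt l p q\<close> does not depend
  on one of \<open>p\<close>, \<open>q\<close>.
\<close>

definition hull_closed :: "real \<Rightarrow> real \<Rightarrow> state set" where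
  "hull_closed A N = {pt l p q | l p q. 0 \<le> l \<and> l \<le> 1 \<and> excess A p \<le> N \<and> excess (- A) q \<le> N
     \<and> 0 \<le> l * (1 - l) * gap A p q \<and> flux A (pt l p q) \<le> N}"

lemma flux_half:
  "flux A (\<theta>, (1 / 2) *\<^sub>R u, (1 / 2) *\<^sub>R m) =
    u \<bullet> (u + A *\<^sub>R m + (2 * \<theta>) *\<^sub>R \<i> + (2 * A) *\<^sub>R \<i>)"
  unfolding flux_def by (simp add: inner_add_right)

lemma cone_form_half:
  "4 * cone_form A (\<theta>, (1 / 2) *\<^sub>R u, (1 / 2) *\<^sub>R m) =
    u \<bullet> (u + A *\<^sub>R m + (2 * \<theta>) *\<^sub>R \<i>)"
  unfolding cone_form_def by (simp add: inner_add_right)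

text \<open>A quadratic function on a segment is the affine interpolation of its end values minus
  \<open>l * (1 - l)\<close> times its quadratic part at the difference of the ends. Here that
  quadratic part is \<open>- gap A p q\<close>.\<close>

lemma flux_pt:
  "flux A (pt l p q) = l * excess A p + (1 - l) * excess (- A) q + l * (1 - l) * gap A p q"
  unfolding pt_def flux_half excess_def gap_def cmod_power2
  by (simp add: inner_complex_def) algebra

lemma flux_lam:
  assumes "cone_form A (z - w) = 0"
  shows "flux A (t *\<^sub>R z + (1 - t) *\<^sub>R w) = t * flux A z + (1 - t) * flux A w"
proof -
  obtain a u m b v n where zw: "z = (a, u, m)" "w = (b, v, n)" by (metis prod_cases3)
  have "flux A (t *\<^sub>R z + (1 - t) *\<^sub>R w) =
      t * flux A z + (1 - t) * flux A w - 4 * t * (1 - t) * cone_form A (z - w)"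
    unfolding zw flux_def cone_form_def by (simp add: inner_complex_def) algebra
  then show ?thesis using assms by simp
qed

text \<open>The hypothesis says \<open>|\<omega>|^2 + Re \<omega> = 0\<close>, and the inner product
  is this quantity times \<open>|V|^2\<close>.\<close>

lemma inner_disc_boundary:
  assumes "cmod (2 * \<omega> + 1) = 1"
  shows "(\<omega> * V) \<bullet> (\<omega> * V + V) = 0"
proof -
  have "(cmod (2 * \<omega> + 1))\<^sup>2 = 1" using assms by simp
  then have "(Re \<omega>)\<^sup>2 + (Im \<omega>)\<^sup>2 + Re \<omega> = 0"
    unfolding cmod_power2 by (simp add: power2_eq_square algebra_simps)
  then show ?thesis by (simp add: inner_complex_def) algebra
qed

lemma cone_form_wave_cone:
  assumes "z \<in> wave_cone A"
  shows "cone_form A z = 0"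
proof -
  obtain \<theta> u m where z: "z = (\<theta>, u, m)" by (metis prod_cases3)
  show ?thesis
  proof (cases "z \<in> wave_cone0 A")
    case True
    then show ?thesis by (simp add: wave_cone0_def cone_form_def z)
  next
    case False
    then obtain \<omega> where w: "cmod (2 * \<omega> + 1) = 1" and u: "u = \<omega> * (A *\<^sub>R m + \<theta> *\<^sub>R \<i>)"
      using assms by (auto simp: wave_cone_def wave_cone1_def z)
    show ?thesis
      using inner_disc_boundary[OF w, of "A *\<^sub>R m + \<theta> *\<^sub>R \<i>"]
      unfolding cone_form_def z u[symmetric] by (simp add: add.assoc)
  qed
qed

text \<open>For \<open>V = 0\<close> the equation forces \<open>u = 0\<close>, and
  \<open>\<omega> = 0\<close> serves; otherwise \<open>\<omega>\<close> is the quotient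
  \<open>u / V\<close>.\<close>

lemma cone_form_zeroE:
  assumes "u \<bullet> (u + V) = 0"
  obtains \<omega> :: complex where "cmod (2 * \<omega> + 1) = 1" "u = \<omega> * V"
proof (cases "V = 0")
  case True
  then show ?thesis using assms that[of 0] by simp
next
  case False
  define \<omega> where "\<omega> = u / V"
  have u: "u = \<omega> * V" using False by (simp add: \<omega>_def)
  have "((Re \<omega>)\<^sup>2 + (Im \<omega>)\<^sup>2 + Re \<omega>) * ((Re V)\<^sup>2 + (Im V)\<^sup>2) = u \<bullet> (u + V)"
    unfolding u by (simp add: inner_complex_def algebra_simps power2_eq_square)
  also have "\<dots> = 0" by (fact assms)
  finally have "((Re \<omega>)\<^sup>2 + (Im \<omega>)\<^sup>2 + Re \<omega>) * ((Re V)\<^sup>2 + (Im V)\<^sup>2) = 0" .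
  moreover have "(Re V)\<^sup>2 + (Im V)\<^sup>2 \<noteq> 0" using False by (simp add: complex_eq_iff)
  ultimately have "(Re \<omega>)\<^sup>2 + (Im \<omega>)\<^sup>2 + Re \<omega> = 0" by (metis mult_eq_0_iff)
  then have "(cmod (2 * \<omega> + 1))\<^sup>2 = 1"
    unfolding cmod_power2 by (simp add: power2_eq_square algebra_simps)
  then have "cmod (2 * \<omega> + 1) = 1"
    by (metis norm_ge_zero one_power2 power2_eq_imp_eq zero_le_one)
  then show ?thesis using u that by blast
qed

text \<open>The condition on \<open>fst z\<close> matters: for \<open>\<theta> = 0\<close> and
  \<open>A \<noteq> 0\<close> the quadric also has points with
  \<open>u \<noteq> - (A *\<^sub>R m)\<close>, which lie outside the cone.\<close>

lemma wave_coneI: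
  assumes "fst z \<noteq> 0" "cone_form A z = 0"
  shows "z \<in> wave_cone A"
proof -
  obtain \<theta> u m where z: "z = (\<theta>, u, m)" by (metis prod_cases3)
  have "u \<bullet> (u + (A *\<^sub>R m + \<theta> *\<^sub>R \<i>)) = 0"
    using assms(2) by (simp add: cone_form_def z add.assoc)
  then obtain \<omega> where "cmod (2 * \<omega> + 1) = 1" "u = \<omega> * (A *\<^sub>R m + \<theta> *\<^sub>R \<i>)"
    by (rule cone_form_zeroE)
  then show ?thesis using assms(1) by (auto simp: wave_cone_def wave_cone1_def z)
qed

lemma cone_form_scale: "cone_form A (l *\<^sub>R z) = l\<^sup>2 * cone_form A z"
  unfolding cone_form_def by (cases z) (simp add: inner_add_right power2_eq_square algebra_simps)

lemma pt_1_minus_pt_0: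
  "pt 1 p q - pt 0 p q = (2, (1 / 2) *\<^sub>R (p - q - 2 * \<i>), (1 / 2) *\<^sub>R (p + q))"
  unfolding pt_def by (simp add: complex_eq_iff diff_divide_distrib add_divide_distrib)

lemma cone_form_pt: "cone_form A (l *\<^sub>R (pt 1 p q - pt 0 p q)) = - (l\<^sup>2 / 4 * gap A p q)"
proof -
  have "4 * cone_form A (pt 1 p q - pt 0 p q) = - gap A p q"
    unfolding pt_1_minus_pt_0 cone_form_half gap_def cmod_power2
    by (simp add: inner_complex_def) algebra
  then have "cone_form A (pt 1 p q - pt 0 p q) = - (gap A p q / 4)" by simp
  then show ?thesis unfolding cone_form_scale by simp
qed

section \<open>Lamination steps and sets stable under lamination\<close>

lemma zero_in_wave_cone: "0 \<in> wave_cone A"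
  by (simp add: wave_cone_def wave_cone0_def zero_prod_def)

lemma lam_stepI:
  assumes "0 \<le> t" "t \<le> 1" "x \<in> K" "y \<in> K" "x - y \<in> \<Lambda>" "z = t *\<^sub>R x + (1 - t) *\<^sub>R y"
  shows "z \<in> lam_step \<Lambda> K"
  unfolding lam_step_def mem_Collect_eq
proof (intro exI conjI)
  show "2 * t - 1 \<in> {-1..1}" using assms by simp
  show "z = ((1 + (2 * t - 1)) / 2) *\<^sub>R x + ((1 - (2 * t - 1)) / 2) *\<^sub>R y"
    using assms(6) by (simp add: diff_divide_distrib)
qed (use assms in auto)

lemma lam_step_superset: "0 \<in> \<Lambda> \<Longrightarrow> K \<subseteq> lam_step \<Lambda> K"
  by (auto intro!: lam_stepI[where t = 1])

lemma lam_hull_subset: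
  assumes "K \<subseteq> X" "lam_step \<Lambda> X \<subseteq> X"
  shows "lam_hull \<Lambda> K \<subseteq> X"
proof -
  have mono: "lam_step \<Lambda> B \<subseteq> lam_step \<Lambda> X" if "B \<subseteq> X" for B
    using that unfolding lam_step_def by blast
  have "lam_iter n \<Lambda> K \<subseteq> X" for n
  proof (induction n)
    case 0
    then show ?case using assms by (simp add: lam_iter_def)
  next
    case (Suc n)
    then show ?case using mono[of "lam_iter n \<Lambda> K"] assms(2) by (auto simp: lam_iter_def)
  qed
  then show ?thesis unfolding lam_hull_def by blast
qed

section \<open>The hull inequalities in two-phase coordinates\<close>

lemma square_minus_1_pos:
  assumes "1 < M"
  shows "0 < M\<^sup>2 - (1::real)"
  using assms by (simp add: power2_eq_square less_1_mult)

lemma excess_le_iff: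
  assumes "- 1 < B"
  shows "excess B p \<le> M\<^sup>2 - 1 \<longleftrightarrow> cmod p \<le> bound_const M B"
proof -
  have "cmod p \<le> bound_const M B \<longleftrightarrow> (cmod p)\<^sup>2 \<le> (M\<^sup>2 + B) / (1 + B)"
    unfolding bound_const_def using real_sqrt_le_iff[of "(cmod p)\<^sup>2"] by simp
  also have "\<dots> \<longleftrightarrow> excess B p \<le> M\<^sup>2 - 1"
    using assms unfolding excess_def by (simp add: field_simps)
  finally show ?thesis by simp
qed

lemma excess_less_iff:
  assumes "- 1 < B"
  shows "excess B p < M\<^sup>2 - 1 \<longleftrightarrow> cmod p < bound_const M B"
proof -
  have "cmod p < bound_const M B \<longleftrightarrow> (cmod p)\<^sup>2 < (M\<^sup>2 + B) / (1 + B)"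
    unfolding bound_const_def using real_sqrt_less_iff[of "(cmod p)\<^sup>2"] by simp
  also have "\<dots> \<longleftrightarrow> excess B p < M\<^sup>2 - 1"
    using assms unfolding excess_def by (simp add: field_simps)
  finally show ?thesis by simp
qed

lemma state_eq_pt:
  assumes "- 1 < fst z" "fst z < 1"
  obtains l p q where "0 < l" "l < 1" "z = pt l p q"
proof -
  obtain \<theta> u m where z: "z = (\<theta>, u, m)" by (metis prod_cases3)
  \<comment> \<open>The parameters solve \<open>u + m = l * (p - \<i>)\<close> and
    \<open>u - m = (1 - l) * (q + \<i>)\<close>.\<close>
  have "z = pt ((1 + \<theta>) / 2) ((2 / (1 + \<theta>)) *\<^sub>R (u + m) + \<i>) ((2 / (1 - \<theta>)) *\<^sub>R (u - m) - \<i>)"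
    using assms unfolding z pt_def by (simp add: complex_eq_iff field_simps)
  moreover have "0 < (1 + \<theta>) / 2" "(1 + \<theta>) / 2 < 1" using assms by (auto simp: z)
  ultimately show ?thesis using that by blast
qed

lemma hull_interior_fst:
  assumes "z \<in> hull_interior A M"
  shows "- 1 < fst z \<and> fst z < 1"
proof -
  obtain \<theta> u m where z: "z = (\<theta>, u, m)" by (metis prod_cases3)
  have "\<theta> \<noteq> 1" "\<theta> \<noteq> - 1" "\<theta> \<in> {-1..1}" using assms by (auto simp: z hull_interior_def)
  then show ?thesis by (auto simp: z)
qed

text \<open>The form in which the gap appears when the first hull inequality is squared and the
  difference of squares is factored.\<close>

lemma gap_factor:
  "gap A p q = - ((p - q - 2 * \<i>) \<bullet> ((1 + A) *\<^sub>R p - (1 - A) *\<^sub>R q + 2 * \<i>))"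
  unfolding gap_def cmod_power2 by (simp add: inner_complex_def) algebra

text \<open>The inequalities translate one by one: the first by squaring, the third and fourth on
  division by \<open>1 - \<theta>\<close> and \<open>1 + \<theta>\<close>, while the second is the
  one on \<open>flux\<close> as it stands.\<close>

lemma pt_in_hull_interior_iff:
  assumes A: "\<bar>A\<bar> < 1" and l: "0 < l" "l < 1"
  shows "pt l p q \<in> hull_interior A M \<longleftrightarrow> 0 < gap A p q \<and> flux A (pt l p q) < M\<^sup>2 - 1
     \<and> excess A p < M\<^sup>2 - 1 \<and> excess (- A) q < M\<^sup>2 - 1"
proof -
  obtain \<theta> u m where z: "pt l p q = (\<theta>, u, m)" by (metis prod_cases3)
  have th: "\<theta> = 2 * l - 1" and u: "u = (1 / 2) *\<^sub>R (l *\<^sub>R (p - \<i>) + (1 - l) *\<^sub>R (q + \<i>))"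
    and m: "m = (1 / 2) *\<^sub>R (l *\<^sub>R (p - \<i>) - (1 - l) *\<^sub>R (q + \<i>))"
    using z by (auto simp: pt_def)
  have pos: "0 < 1 - \<theta> * A" "0 < 1 - \<theta>\<^sup>2" 
  proof -
    have "\<bar>\<theta> * A\<bar> < 1" using mult_strict_mono'[of "\<bar>\<theta>\<bar>" 1 "\<bar>A\<bar>" 1] A l by (simp add: th abs_mult)
    then show "0 < 1 - \<theta> * A" by linarith
    have "1 - \<theta>\<^sup>2 = 4 * (l * (1 - l))" by (simp add: th power2_eq_square algebra_simps)
    then show "0 < 1 - \<theta>\<^sup>2" using l by simp
  qed
  define X Y where "X = (2 * (1 - \<theta> * A)) *\<^sub>R (m - \<theta> *\<^sub>R u) + (1 - \<theta>\<^sup>2) *\<^sub>R (A *\<^sub>R u + \<i>)"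
    and "Y = A *\<^sub>R u + \<i>"
  have "(cmod X)\<^sup>2 - ((1 - \<theta>\<^sup>2) * cmod Y)\<^sup>2 = - ((1 - \<theta> * A) * (1 - \<theta>\<^sup>2)\<^sup>2 / 4 * gap A p q)"
  proof -
    define D where "D = m - \<theta> *\<^sub>R u"
    have D: "D = (l * (1 - l)) *\<^sub>R (p - q - 2 * \<i>)"
      unfolding D_def th u m by (simp add: complex_eq_iff field_simps)
    have th2: "1 - \<theta>\<^sup>2 = 4 * (l * (1 - l))"
      by (simp add: th power2_eq_square algebra_simps)
    have S: "(1 - \<theta> * A) *\<^sub>R D + (1 - \<theta>\<^sup>2) *\<^sub>R Y =
        (l * (1 - l)) *\<^sub>R ((1 + A) *\<^sub>R p - (1 - A) *\<^sub>R q + 2 * \<i>)"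
      unfolding D Y_def th2 unfolding th u by (simp add: complex_eq_iff algebra_simps)
    \<comment> \<open>For scalars \<open>c\<close> and \<open>e\<close>,
      \<open>|2cD + eY|^2 - |eY|^2\<close> equals 4c times the inner product of \<open>D\<close> and
      \<open>cD + eY\<close>. By the facts \<open>D\<close> and \<open>S\<close>, both vectors carry
      a factor \<open>l * (1 - l)\<close>.\<close>
    have "(cmod X)\<^sup>2 - ((1 - \<theta>\<^sup>2) * cmod Y)\<^sup>2 =
        4 * (1 - \<theta> * A) * (D \<bullet> ((1 - \<theta> * A) *\<^sub>R D + (1 - \<theta>\<^sup>2) *\<^sub>R Y))"
      unfolding X_def D_def[symmetric] Y_def[symmetric] power_mult_distrib cmod_power2
      by (simp add: inner_complex_def) algebra
    also have "\<dots> = - (4 * (1 - \<theta> * A) * (l * (1 - l))\<^sup>2 * gap A p q)"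
      unfolding S unfolding D gap_factor by (simp add: power2_eq_square)
    finally show ?thesis unfolding th2 by (simp add: power2_eq_square)
  qed
  moreover have "cmod X < (1 - \<theta>\<^sup>2) * cmod Y \<longleftrightarrow> (cmod X)\<^sup>2 < ((1 - \<theta>\<^sup>2) * cmod Y)\<^sup>2"
    using pos power_mono_iff[of "(1 - \<theta>\<^sup>2) * cmod Y" "cmod X" 2] by (simp add: not_le[symmetric])
  moreover have "0 < (1 - \<theta> * A) * (1 - \<theta>\<^sup>2)\<^sup>2 / 4" using pos by simp
  ultimately have c1: "cmod X < (1 - \<theta>\<^sup>2) * cmod Y \<longleftrightarrow> 0 < gap A p q"
    by (smt (verit) zero_less_mult_iff)
  have "2 * (m - u) + (1 - \<theta>) *\<^sub>R \<i> = (- (1 - \<theta>)) *\<^sub>R q"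
    unfolding th u m by (simp add: complex_eq_iff field_simps)
  then have "cmod (2 * (m - u) + (1 - \<theta>) *\<^sub>R \<i>) = (1 - \<theta>) * cmod q"
    using l by (simp add: th)
  then have c3: "cmod (2 * (m - u) + (1 - \<theta>) *\<^sub>R \<i>) < bound_const M (- A) * (1 - \<theta>) \<longleftrightarrow>
      excess (- A) q < M\<^sup>2 - 1"
    using l A by (simp add: th excess_less_iff mult.commute)
  have "2 * (m + u) + (1 + \<theta>) *\<^sub>R \<i> = (1 + \<theta>) *\<^sub>R p"
    unfolding th u m by (simp add: complex_eq_iff field_simps)
  then have "cmod (2 * (m + u) + (1 + \<theta>) *\<^sub>R \<i>) = (1 + \<theta>) * cmod p"
    using l by (simp add: th)
  then have c4: "cmod (2 * (m + u) + (1 + \<theta>) *\<^sub>R \<i>) < bound_const M A * (1 + \<theta>) \<longleftrightarrow>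
      excess A p < M\<^sup>2 - 1"
    using l A by (simp add: th excess_less_iff mult.commute)
  have "\<theta> \<in> {-1..1}" using l by (simp add: th)
  then show ?thesis
    unfolding z hull_interior_def using c1 c3 c4 by (auto simp: X_def Y_def flux_def)
qed

section \<open>Stability of the closed hull under lamination\<close>

text \<open>Here \<open>p\<close> and \<open>q\<close> occur only in the products
  \<open>l *\<^sub>R p\<close> and \<open>(1 - l) *\<^sub>R q\<close>, so equations for these
  products can be used for rewriting.\<close>

lemma pt_alt:
  "pt l p q = (2 * l - 1, (1 / 2) *\<^sub>R (l *\<^sub>R p + (1 - l) *\<^sub>R q + (1 - 2 * l) *\<^sub>R \<i>),
     (1 / 2) *\<^sub>R (l *\<^sub>R p - (1 - l) *\<^sub>R q - \<i>))"
  unfolding pt_def by (simp add: complex_eq_iff algebra_simps)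

text \<open>Each phase is mixed separately, with weights given by its share in the two
  states.\<close>

lemma pt_mean:
  assumes l: "l = t * l1 + (1 - t) * l2"
    and p: "l *\<^sub>R p = (t * l1) *\<^sub>R p1 + ((1 - t) * l2) *\<^sub>R p2"
    and q: "(1 - l) *\<^sub>R q = (t * (1 - l1)) *\<^sub>R q1 + ((1 - t) * (1 - l2)) *\<^sub>R q2"
  shows "pt l p q = t *\<^sub>R pt l1 p1 q1 + (1 - t) *\<^sub>R pt l2 p2 q2"
  unfolding pt_alt p q unfolding l by (simp add: complex_eq_iff) algebra

text \<open>Convexity with unnormalised weights, which also covers a phase that is absent from both
  states.\<close>

lemma excess_mean:
  assumes B: "- 1 < B" and ab: "0 \<le> \<alpha>" "0 \<le> \<beta>" and xy: "excess B x \<le> N" "excess B y \<le> N"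
  obtains z where "(\<alpha> + \<beta>) *\<^sub>R z = \<alpha> *\<^sub>R x + \<beta> *\<^sub>R y"
    "(\<alpha> + \<beta>) * excess B z \<le> \<alpha> * excess B x + \<beta> * excess B y" "excess B z \<le> N"
proof (cases "\<alpha> + \<beta> = 0")
  case True
  then have "\<alpha> = 0" "\<beta> = 0" using ab by auto
  \<comment> \<open>With both weights zero any admissible point will do.\<close>
  then show ?thesis using that[of x] xy by simp
next
  case False
  then have pos: "0 < \<alpha> + \<beta>" using ab by simp
  define z where "z = (1 / (\<alpha> + \<beta>)) *\<^sub>R (\<alpha> *\<^sub>R x + \<beta> *\<^sub>R y)"
  have z: "(\<alpha> + \<beta>) *\<^sub>R z = \<alpha> *\<^sub>R x + \<beta> *\<^sub>R y" using pos by (simp add: z_def)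
  have "(\<alpha> + \<beta>)\<^sup>2 * (cmod z)\<^sup>2 = (cmod ((\<alpha> + \<beta>) *\<^sub>R z))\<^sup>2" by (simp add: power_mult_distrib)
  also have "\<dots> = (\<alpha> + \<beta>) * (\<alpha> * (cmod x)\<^sup>2 + \<beta> * (cmod y)\<^sup>2) - \<alpha> * \<beta> * (cmod (x - y))\<^sup>2"
    unfolding z cmod_power2 by simp algebra
  also have "\<dots> \<le> (\<alpha> + \<beta>) * (\<alpha> * (cmod x)\<^sup>2 + \<beta> * (cmod y)\<^sup>2)" using ab by simp
  finally have "(\<alpha> + \<beta>) * ((\<alpha> + \<beta>) * (cmod z)\<^sup>2) \<le> (\<alpha> + \<beta>) * (\<alpha> * (cmod x)\<^sup>2 + \<beta> * (cmod y)\<^sup>2)"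
    by (simp add: power2_eq_square mult.assoc)
  then have "(\<alpha> + \<beta>) * (cmod z)\<^sup>2 \<le> \<alpha> * (cmod x)\<^sup>2 + \<beta> * (cmod y)\<^sup>2"
    using pos by (simp only: mult_le_cancel_left_pos)
  then have "(1 + B) * ((\<alpha> + \<beta>) * (cmod z)\<^sup>2 - (\<alpha> + \<beta>)) \<le>
      (1 + B) * (\<alpha> * (cmod x)\<^sup>2 + \<beta> * (cmod y)\<^sup>2 - (\<alpha> + \<beta>))"
    using B by (intro mult_left_mono) auto
  then have e: "(\<alpha> + \<beta>) * excess B z \<le> \<alpha> * excess B x + \<beta> * excess B y"
    unfolding excess_def by (simp add: algebra_simps)
  also have "\<dots> \<le> \<alpha> * N + \<beta> * N" using ab xy by (intro add_mono mult_left_mono) auto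
  also have "\<dots> = (\<alpha> + \<beta>) * N" by (simp add: algebra_simps)
  finally have "excess B z \<le> N" using pos by (simp only: mult_le_cancel_left_pos)
  then show ?thesis using that z e by blast
qed

lemma lam_step_hull_closed:
  assumes A: "\<bar>A\<bar> < 1"
  shows "lam_step (wave_cone A) (hull_closed A N) \<subseteq> hull_closed A N"
proof
  fix z assume "z \<in> lam_step (wave_cone A) (hull_closed A N)"
  then obtain s z1 z2 where s: "s \<in> {-1..1}" and z12: "z1 \<in> hull_closed A N" "z2 \<in> hull_closed A N"
    and cone: "z1 - z2 \<in> wave_cone A" and z: "z = ((1 + s) / 2) *\<^sub>R z1 + ((1 - s) / 2) *\<^sub>R z2"
    unfolding lam_step_def by blast
  define t where "t = (1 + s) / 2"
  have t: "0 \<le> t" "t \<le> 1" and z': "z = t *\<^sub>R z1 + (1 - t) *\<^sub>R z2"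
    using s z by (auto simp: t_def diff_divide_distrib add_divide_distrib)
  obtain l1 p1 q1 where 1: "z1 = pt l1 p1 q1" "0 \<le> l1" "l1 \<le> 1" "excess A p1 \<le> N" "excess (- A) q1 \<le> N"
    "0 \<le> l1 * (1 - l1) * gap A p1 q1" "flux A z1 \<le> N" using z12(1) unfolding hull_closed_def by blast
  obtain l2 p2 q2 where 2: "z2 = pt l2 p2 q2" "0 \<le> l2" "l2 \<le> 1" "excess A p2 \<le> N" "excess (- A) q2 \<le> N"
    "0 \<le> l2 * (1 - l2) * gap A p2 q2" "flux A z2 \<le> N" using z12(2) unfolding hull_closed_def by blast
  define l where "l = t * l1 + (1 - t) * l2"
  have l': "1 - l = t * (1 - l1) + (1 - t) * (1 - l2)" by (simp add: l_def algebra_simps)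
  have nn: "0 \<le> t * l1" "0 \<le> (1 - t) * l2" "0 \<le> t * (1 - l1)" "0 \<le> (1 - t) * (1 - l2)"
    using t 1 2 by auto
  have l: "0 \<le> l" "l \<le> 1" using nn l' by (auto simp: l_def)
  obtain p where p: "l *\<^sub>R p = (t * l1) *\<^sub>R p1 + ((1 - t) * l2) *\<^sub>R p2"
    "l * excess A p \<le> t * l1 * excess A p1 + (1 - t) * l2 * excess A p2" "excess A p \<le> N"
    using excess_mean[of A "t * l1" "(1 - t) * l2" p1 N p2] nn 1 2 A unfolding l_def by force
  obtain q where q: "(1 - l) *\<^sub>R q = (t * (1 - l1)) *\<^sub>R q1 + ((1 - t) * (1 - l2)) *\<^sub>R q2"
    "(1 - l) * excess (- A) q \<le> t * (1 - l1) * excess (- A) q1 + (1 - t) * (1 - l2) * excess (- A) q2"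
    "excess (- A) q \<le> N"
    using excess_mean[of "- A" "t * (1 - l1)" "(1 - t) * (1 - l2)" q1 N q2] nn 1 2 A unfolding l' by force
  have zpt: "z = pt l p q" unfolding z' 1(1) 2(1) using pt_mean[OF l_def p(1) q(1)] by simp
  have fz: "flux A z = t * flux A z1 + (1 - t) * flux A z2"
    unfolding z' by (intro flux_lam cone_form_wave_cone cone)
  also have "\<dots> \<le> t * N + (1 - t) * N" using t 1 2 by (intro add_mono mult_left_mono) auto
  finally have fN: "flux A z \<le> N" by (simp add: algebra_simps)
  \<comment> \<open>\<open>flux_pt\<close> is solved for the gap term. The flux is affine along the
    segment, and the subtracted excess terms are at most the weighted ones at its ends.\<close>
  have "l * (1 - l) * gap A p q = flux A z - l * excess A p - (1 - l) * excess (- A) q"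
    unfolding zpt flux_pt by simp
  also have "\<dots> \<ge> t * (l1 * (1 - l1) * gap A p1 q1) + (1 - t) * (l2 * (1 - l2) * gap A p2 q2)"
    using p(2) q(2) unfolding fz unfolding 1(1) 2(1) flux_pt by (simp add: algebra_simps)
  moreover have "0 \<le> t * (l1 * (1 - l1) * gap A p1 q1) + (1 - t) * (l2 * (1 - l2) * gap A p2 q2)"
    using t 1 2 by auto
  ultimately have "0 \<le> l * (1 - l) * gap A p q" by linarith
  then show "z \<in> hull_closed A N"
    unfolding hull_closed_def using zpt l p(3) q(3) fN by blast
qed

section \<open>Compactness of the closed hull\<close>

lemma continuous_on_excess [continuous_intros]:
  "continuous_on S f \<Longrightarrow> continuous_on S (\<lambda>x. excess B (f x))"
  unfolding excess_def by (intro continuous_intros)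

lemma continuous_on_gap [continuous_intros]:
  "continuous_on S f \<Longrightarrow> continuous_on S g \<Longrightarrow> continuous_on S (\<lambda>x. gap A (f x) (g x))"
  unfolding gap_def by (intro continuous_intros)

lemma continuous_on_pt [continuous_intros]:
  "continuous_on S l \<Longrightarrow> continuous_on S f \<Longrightarrow> continuous_on S g \<Longrightarrow>
    continuous_on S (\<lambda>x. pt (l x) (f x) (g x))"
  unfolding pt_def by (intro continuous_intros)

lemma excess_le_imp_cball:
  assumes "- 1 < B" "excess B p \<le> N"
  shows "p \<in> cball 0 (sqrt (N / (1 + B) + 1))"
proof -
  have "(cmod p)\<^sup>2 \<le> N / (1 + B) + 1" using assms by (simp add: excess_def field_simps)
  then show ?thesis by (simp add: real_le_rsqrt)
qed

text \<open>The closed hull is the continuous image under \<open>pt\<close> of a closed and bounded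
  set of triples \<open>(l, p, q)\<close>; \<open>flux_pt\<close> expresses the flux condition
  through these coordinates.\<close>

lemma compact_hull_closed:
  assumes A: "\<bar>A\<bar> < 1"
  shows "compact (hull_closed A N)"
proof -
  define S :: "(real \<times> complex \<times> complex) set" where
    "S = {0..1} \<times> cball 0 (sqrt (N / (1 + A) + 1)) \<times> cball 0 (sqrt (N / (1 - A) + 1))"
  define C where "C = {x. excess A (fst (snd x)) \<le> N} \<inter> {x. excess (- A) (snd (snd x)) \<le> N} \<inter>
    {x. 0 \<le> fst x * (1 - fst x) * gap A (fst (snd x)) (snd (snd x))} \<inter>
    {x. fst x * excess A (fst (snd x)) + (1 - fst x) * excess (- A) (snd (snd x)) +
        fst x * (1 - fst x) * gap A (fst (snd x)) (snd (snd x)) \<le> N}"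
  have "closed C" unfolding C_def
    by (intro closed_Int closed_Collect_le continuous_intros)
  moreover have "compact S" unfolding S_def by (intro compact_Times compact_cball compact_Icc)
  ultimately have "compact (S \<inter> C)" by blast
  then have "compact ((\<lambda>x. pt (fst x) (fst (snd x)) (snd (snd x))) ` (S \<inter> C))"
    by (intro compact_continuous_image continuous_intros)
  also have "(\<lambda>x. pt (fst x) (fst (snd x)) (snd (snd x))) ` (S \<inter> C) = hull_closed A N"
  proof (intro equalityI subsetI)
    fix z assume "z \<in> hull_closed A N"
    then obtain l p q where z: "z = pt l p q" "0 \<le> l" "l \<le> 1" "excess A p \<le> N" "excess (- A) q \<le> N"
      "0 \<le> l * (1 - l) * gap A p q" "flux A (pt l p q) \<le> N" unfolding hull_closed_def by blast
    have "(l, p, q) \<in> S \<inter> C"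
      using z excess_le_imp_cball[of A p N] excess_le_imp_cball[of "- A" q N] A
      by (auto simp: S_def C_def flux_pt)
    then show "z \<in> (\<lambda>x. pt (fst x) (fst (snd x)) (snd (snd x))) ` (S \<inter> C)"
      unfolding z(1) by force
  next
    fix z assume "z \<in> (\<lambda>x. pt (fst x) (fst (snd x)) (snd (snd x))) ` (S \<inter> C)"
    then obtain l p q where "z = pt l p q" "(l, p, q) \<in> S \<inter> C" by auto
    then show "z \<in> hull_closed A N"
      unfolding hull_closed_def mem_Collect_eq
      by (intro exI[of _ l] exI[of _ p] exI[of _ q]) (auto simp: S_def C_def flux_pt)
  qed
  finally show ?thesis .
qed

section \<open>Laminates with at most three steps\<close>

text \<open>For \<open>p = - a\<i>\<close> and \<open>q = - b\<i>\<close> the claim is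
  \<open>0 \<le> gap A p q\<close>. With the roles of \<open>a\<close>, \<open>b\<close> exchanged
  and \<open>A\<close> negated it covers \<open>p = a\<i>\<close>, \<open>q = b\<i>\<close>. These
  are the extreme cases needed in \<open>gap_partner\<close>.\<close>

lemma partner_ineq:
  fixes A a b :: real
  assumes A: "\<bar>A\<bar> < 1" and ab: "1 \<le> a" "1 \<le> b" and eq: "(1 + A) * (a\<^sup>2 - 1) = (1 - A) * (b\<^sup>2 - 1)"
  shows "(1 + A) * (a\<^sup>2 - 1) - 1 \<le> a * b - A * (a + b)"
proof -
  \<comment> \<open>These are the imaginary parts of the two vectors in \<open>gap_factor\<close>
    for the values above, so the gap is \<open>- x * y\<close>. The excess equation makes their
    signs opposite.\<close>
  define x y where "x = b - a - 2" and "y = (1 - A) * b - (1 + A) * a + 2"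
  have xy: "(b - 1) * y = - (1 + A) * (a - 1) * x"
    using eq unfolding x_def y_def by algebra
  have "x * y \<le> 0"
  proof (cases "b = 1")
    case True
    then have "a\<^sup>2 = 1" using eq A by auto
    then have "a = 1" using ab by (metis abs_of_nonneg abs_square_eq_1 le_numeral_extra(1) order_trans)
    then show ?thesis using True A by (simp add: x_def y_def)
  next
    case False
    then have "(b - 1) * (x * y) = - ((1 + A) * (a - 1) * x\<^sup>2)" using xy by algebra
    also have "\<dots> \<le> 0" using A ab by simp
    finally show ?thesis using False ab by (simp add: mult_le_0_iff)
  qed
  moreover define L R where "L = (1 + A) * (a\<^sup>2 - 1) - 1" and "R = a * b - A * (a + b)"
  moreover have "x * y = 2 * L - 2 * R"
    using eq unfolding x_def y_def L_def R_def by algebra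
  ultimately have "L \<le> R" by linarith
  then show ?thesis by (simp add: L_def R_def)
qed

text \<open>In the orthogonal basis \<open>v\<close>, \<open>\<i> * v\<close> the line fixes the
  first coordinate and the radius fixes the second up to sign; the inequality makes the square of
  the latter nonnegative.\<close>

lemma circle_meets_line:
  fixes v :: complex
  assumes "v \<noteq> 0" "c\<^sup>2 \<le> b\<^sup>2 * (cmod v)\<^sup>2"
  obtains q where "q \<bullet> v = c" "(cmod q)\<^sup>2 = b\<^sup>2"
proof -
  define r where "r = sqrt (b\<^sup>2 * (cmod v)\<^sup>2 - c\<^sup>2)"
  have r: "r\<^sup>2 = b\<^sup>2 * (cmod v)\<^sup>2 - c\<^sup>2" using assms by (simp add: r_def)
  define w where "w = c *\<^sub>R v + r *\<^sub>R (\<i> * v)"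
  have "w \<bullet> v = c * (cmod v)\<^sup>2"
    unfolding w_def cmod_power2 by (simp add: inner_complex_def) algebra
  moreover have "(cmod w)\<^sup>2 = (c\<^sup>2 + r\<^sup>2) * (cmod v)\<^sup>2"
    unfolding w_def cmod_power2 by simp algebra
  moreover have "c\<^sup>2 + r\<^sup>2 = b\<^sup>2 * (cmod v)\<^sup>2" by (simp add: r)
  ultimately have "w \<bullet> v = c * (cmod v)\<^sup>2" "(cmod w)\<^sup>2 = b\<^sup>2 * ((cmod v)\<^sup>2)\<^sup>2"
    by (simp_all add: power2_eq_square[of "(cmod v)\<^sup>2"])
  then have "((1 / (cmod v)\<^sup>2) *\<^sub>R w) \<bullet> v = c" "(cmod ((1 / (cmod v)\<^sup>2) *\<^sub>R w))\<^sup>2 = b\<^sup>2"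
    using assms(1) by (simp_all add: power_divide)
  then show ?thesis by (rule that)
qed

text \<open>The prescribed excess fixes \<open>cmod q = b\<close>. Then \<open>gap A p q = 0\<close>
  becomes a linear equation for the inner product of \<open>q\<close> with
  \<open>v = p + A\<i>\<close>, so a circle has to meet a line.\<close>

lemma gap_partner:
  assumes A: "\<bar>A\<bar> < 1" and p: "1 \<le> cmod p"
  obtains q where "excess (- A) q = excess A p" "gap A p q = 0"
proof -
  define a n b where "a = cmod p" and "n = excess A p" and "b = sqrt (1 + n / (1 - A))"
  have n: "n = (1 + A) * (a\<^sup>2 - 1)" by (simp add: n_def excess_def a_def)
  have n0: "0 \<le> n" using p A unfolding n a_def by simp
  have b2: "b\<^sup>2 = 1 + n / (1 - A)" and b1: "1 \<le> b" using n0 A by (auto simp: b_def)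
  have nb: "n = (1 - A) * (b\<^sup>2 - 1)" using A by (simp add: b2)
  have eq: "(1 + A) * (a\<^sup>2 - 1) = (1 - A) * (b\<^sup>2 - 1)" using n nb by simp
  define y where "y = Im p"
  have y: "\<bar>y\<bar> \<le> a" by (simp add: y_def a_def abs_Im_le_cmod)
  have a1: "1 \<le> a" using p by (simp add: a_def)
  define v where "v = p + A *\<^sub>R \<i>"
  have v2: "(cmod v)\<^sup>2 = a\<^sup>2 + A\<^sup>2 + 2 * A * y"
    unfolding v_def a_def y_def cmod_power2 by (simp add: power2_eq_square algebra_simps)
  have "v \<noteq> 0"
  proof
    assume "v = 0"
    then have "p = - (A *\<^sub>R \<i>)" by (simp add: v_def add_eq_0_iff2)
    then have "cmod p = \<bar>A\<bar>" by simp
    then show False using A p by simp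
  qed
  \<comment> \<open>At \<open>t = A * y\<close> this is the difference of the two sides of the
    inequality required by \<open>circle_meets_line\<close>.\<close>
  define G where "G = (\<lambda>t. b\<^sup>2 * (a\<^sup>2 + A\<^sup>2 + 2 * t) - (n - 1 - t)\<^sup>2)"
  have i1: "n - 1 \<le> a * b - A * (a + b)" using partner_ineq[OF A a1 b1 eq] n by simp
  have i2: "n - 1 \<le> a * b + A * (a + b)" using partner_ineq[of "- A" b a] A a1 b1 eq nb
    by (simp add: algebra_simps)
  have pp: "1 * 1 \<le> (a + A) * (b - A) + A\<^sup>2" "1 * 1 \<le> (a - A) * (b + A) + A\<^sup>2"
  proof -
    have "(1 + A) * (1 - A) \<le> (a + A) * (b - A)" using A a1 b1 by (intro mult_mono) auto
    then show "1 * 1 \<le> (a + A) * (b - A) + A\<^sup>2" by (simp add: power2_eq_square algebra_simps)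
    have "(1 - A) * (1 + A) \<le> (a - A) * (b + A)" using A a1 b1 by (intro mult_mono) auto
    then show "1 * 1 \<le> (a - A) * (b + A) + A\<^sup>2" by (simp add: power2_eq_square algebra_simps)
  qed
  \<comment> \<open>At the extreme values \<open>a\<^sup>2 + A\<^sup>2 + 2 * t\<close> is the square
    of \<open>a + A\<close> or \<open>a - A\<close>, so \<open>G\<close> factors as a difference of
    squares; \<open>i1\<close>, \<open>i2\<close> and \<open>pp\<close> give the signs of the
    factors.\<close>
  have "G (A * a) = (a * b + A * (a + b) - (n - 1)) * ((a + A) * (b - A) + A\<^sup>2 + n - 1)"
    unfolding G_def by algebra
  then have G1: "0 \<le> G (A * a)" using i2 pp n0 by simp
  have "G (- A * a) = (a * b - A * (a + b) - (n - 1)) * ((a - A) * (b + A) + A\<^sup>2 + n - 1)"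
    unfolding G_def by algebra
  then have G2: "0 \<le> G (- A * a)" using i1 pp n0 by simp
  define \<mu> where "\<mu> = (1 + y / a) / 2"
  have mu: "0 \<le> \<mu>" "\<mu> \<le> 1" using y a1 by (auto simp: \<mu>_def field_simps)
  have "2 * \<mu> - 1 = y / a" unfolding \<mu>_def by (simp add: add_divide_distrib)
  then have ya: "y = (2 * \<mu> - 1) * a" using a1 by simp
  \<comment> \<open>\<open>G\<close> is concave, so it suffices to look at the extreme values \<open>y = \<plusminus>a\<close>.\<close>
  have "G (A * y) = \<mu> * G (A * a) + (1 - \<mu>) * G (- A * a) + 4 * \<mu> * (1 - \<mu>) * (A * a)\<^sup>2"
    unfolding G_def ya by algebra
  also have "\<dots> \<ge> 0" using mu G1 G2 by simp
  finally have "(n - 1 - A * y)\<^sup>2 \<le> b\<^sup>2 * (cmod v)\<^sup>2"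
    by (simp add: G_def v2 mult.assoc)
  then obtain q where q: "q \<bullet> v = n - 1 - A * y" "(cmod q)\<^sup>2 = b\<^sup>2"
    using circle_meets_line \<open>v \<noteq> 0\<close> by blast
  have "gap A p q = 2 - 2 * n + 2 * A * y + 2 * (q \<bullet> v)"
    using q(2) n nb unfolding gap_def y_def v_def a_def
    by (simp add: inner_complex_def algebra_simps)
  then have "gap A p q = 0" using q(1) by simp
  moreover have "excess (- A) q = excess A p" using q(2) nb by (simp add: excess_def n_def)
  ultimately show ?thesis using that by blast
qed

section \<open>Laminates of order one and two\<close>

lemma lam_iter_Suc: "lam_iter (Suc n) \<Lambda> K = lam_step \<Lambda> (lam_iter n \<Lambda> K)"
  by (simp add: lam_iter_def)

lemma lam_iter_mono_Suc: "0 \<in> \<Lambda> \<Longrightarrow> lam_iter n \<Lambda> K \<subseteq> lam_iter (Suc n) \<Lambda> K"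
  unfolding lam_iter_Suc by (rule lam_step_superset)

lemma pt_1_in_bounded_constraint_set:
  assumes "\<bar>A\<bar> < 1" "excess A p \<le> M\<^sup>2 - 1"
  shows "pt 1 p q \<in> bounded_constraint_set A M"
proof -
  have "cmod p \<le> bound_const M A" using assms by (simp add: excess_le_iff)
  moreover have "2 * ((1 / 2) *\<^sub>R (p - \<i>)) + \<i> = p" by (simp add: complex_eq_iff diff_divide_distrib)
  ultimately show ?thesis
    by (simp add: pt_def bounded_constraint_set_def constraint_set_def)
qed

lemma pt_0_in_bounded_constraint_set:
  assumes "\<bar>A\<bar> < 1" "excess (- A) q \<le> M\<^sup>2 - 1"
  shows "pt 0 p q \<in> bounded_constraint_set A M"
proof -
  have "cmod q \<le> bound_const M (- A)" using assms by (simp add: excess_le_iff)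
  moreover have "2 * ((1 / 2) *\<^sub>R (q + \<i>)) - \<i> = q" by (simp add: complex_eq_iff add_divide_distrib)
  moreover have "pt 0 p q = (- 1, (1 / 2) *\<^sub>R (q + \<i>), - ((1 / 2) *\<^sub>R (q + \<i>)))"
    by (simp add: pt_def complex_eq_iff diff_divide_distrib add_divide_distrib)
  ultimately show ?thesis
    by (simp add: bounded_constraint_set_def constraint_set_def)
qed

text \<open>At \<open>l = 0\<close> or \<open>l = 1\<close> the point is already in the constraint
  set; otherwise the zero gap makes the segment between its two phases a cone segment.\<close>

lemma pt_in_lam_iter_1:
  assumes A: "\<bar>A\<bar> < 1" and l: "0 \<le> l" "l \<le> 1"
    and p: "excess A p \<le> M\<^sup>2 - 1" and q: "excess (- A) q \<le> M\<^sup>2 - 1"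
    and g: "l * (1 - l) * gap A p q = 0"
  shows "pt l p q \<in> lam_iter (Suc 0) (wave_cone A) (bounded_constraint_set A M)"
proof -
  consider "l = 0" | "l = 1" | "gap A p q = 0" using g by auto
  then show ?thesis
  proof cases
    case 1
    then show ?thesis
      using pt_0_in_bounded_constraint_set[OF A q] lam_iter_mono_Suc[OF zero_in_wave_cone, of 0]
      by (auto simp: lam_iter_def)
  next
    case 2
    then show ?thesis
      using pt_1_in_bounded_constraint_set[OF A p] lam_iter_mono_Suc[OF zero_in_wave_cone, of 0]
      by (auto simp: lam_iter_def)
  next
    case 3
    have "pt 1 p q - pt 0 p q \<in> wave_cone A"
      using cone_form_pt[of A 1 p q] 3 by (intro wave_coneI) (auto simp: pt_1_minus_pt_0)
    moreover have "pt l p q = l *\<^sub>R pt 1 p q + (1 - l) *\<^sub>R pt 0 p q"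
      by (rule pt_mean) auto
    ultimately show ?thesis
      unfolding lam_iter_Suc using l pt_1_in_bounded_constraint_set[OF A p] pt_0_in_bounded_constraint_set[OF A q]
      by (intro lam_stepI[of l "pt 1 p q" _ "pt 0 p q"]) (auto simp: lam_iter_def)
  qed
qed

text \<open>In its last argument the gap is quadratic with leading part
  \<open>- (1 - A) * (cmod q)\<^sup>2\<close>, hence concave when \<open>A < 1\<close>.\<close>

lemma gap_line:
  "gap A p (x + s *\<^sub>R (y - x)) =
    (1 - s) * gap A p x + s * gap A p y + s * (1 - s) * ((1 - A) * (cmod (y - x))\<^sup>2)"
  unfolding gap_def cmod_power2 by (simp add: inner_complex_def) algebra

lemma pt_in_lam_iter_2:
  assumes A: "\<bar>A\<bar> < 1" and M: "1 < M" and l: "0 < l" "l < 1"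
    and p: "excess A p = M\<^sup>2 - 1" and q: "excess (- A) q \<le> M\<^sup>2 - 1"
    and g: "0 < gap A p q" and fl: "flux A (pt l p q) \<le> M\<^sup>2 - 1"
  shows "pt l p q \<in> lam_iter (Suc (Suc 0)) (wave_cone A) (bounded_constraint_set A M)"
proof -
  define N where "N = M\<^sup>2 - 1"
  have N: "0 < N" using square_minus_1_pos[OF M] by (simp add: N_def)
  have "1 \<le> cmod p"
  proof (rule ccontr)
    assume "\<not> 1 \<le> cmod p"
    then have "(cmod p)\<^sup>2 \<le> 1" by (simp add: power_le_one)
    then have "excess A p \<le> 0" using A unfolding excess_def by (intro mult_nonneg_nonpos) auto
    then show False using p N by (simp add: N_def)
  qed
  then obtain q1 where q1: "excess (- A) q1 = N" "gap A p q1 = 0"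
    using gap_partner[OF A] p unfolding N_def by metis
  define k f where "k = (1 - A) * (cmod (q - q1))\<^sup>2" and "f = gap A p q"
  have f: "0 < f" using g by (simp add: f_def)
  have "q \<noteq> q1" using g q1 by auto
  then have k: "0 < k" using A by (simp add: k_def)
  \<comment> \<open>Along the line from \<open>q1\<close> through \<open>q\<close> the gap is
    \<open>s * (f + (1 - s) * k)\<close>. The second root is \<open>s\<close>, so \<open>r\<close>
    lies beyond \<open>q\<close>, and \<open>\<alpha>\<close> is the weight of \<open>q1\<close>
    when \<open>q\<close> is written as a mean of \<open>q1\<close> and \<open>r\<close>.\<close>
  define s \<alpha> where "s = (f + k) / k" and "\<alpha> = f / (f + k)"
  define r where "r = q1 + s *\<^sub>R (q - q1)"
  have "gap A p r = s * f + s * (1 - s) * k"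
    unfolding r_def gap_line using q1(2) by (simp add: f_def k_def)
  also have "\<dots> = 0" using k by (simp add: s_def field_simps)
  finally have r: "gap A p r = 0" .
  have a: "0 < \<alpha>" "\<alpha> < 1" using f k by (auto simp: \<alpha>_def)
  have "1 - \<alpha> = k / (f + k)" using f k by (simp add: \<alpha>_def field_simps)
  then have "(1 - \<alpha>) * s = 1" using f k by (simp add: s_def)
  then have "(1 - \<alpha>) *\<^sub>R (r - q1) = q - q1" unfolding r_def by simp
  then have qr: "q = \<alpha> *\<^sub>R q1 + (1 - \<alpha>) *\<^sub>R r" by (simp add: algebra_simps)
  \<comment> \<open>Comparing the coefficients of \<open>q1\<close> in the second phase forces
    \<open>1 - l1 = \<alpha> * (1 - l)\<close>.\<close>
  define l1 where "l1 = 1 - \<alpha> * (1 - l)"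
  have l1d: "l1 - l = (1 - \<alpha>) * (1 - l)" by (simp add: l1_def algebra_simps)
  have "0 < (1 - \<alpha>) * (1 - l)" "0 < \<alpha> * (1 - l)" using a l by auto
  then have l1: "l < l1" "l1 < 1" using l1d by (auto simp: l1_def)
  \<comment> \<open>With this choice the two ends differ by \<open>l1\<close> times the segment
    between the phases \<open>p\<close> and \<open>r\<close>, a cone direction because
    \<open>gap A p r = 0\<close>.\<close>
  define q2 where "q2 = l1 *\<^sub>R r + (1 - l1) *\<^sub>R q1"
  define t where "t = l / l1"
  have t: "0 < t" "t < 1" and tl: "t * l1 = l" using l l1 by (auto simp: t_def)
  have z: "pt l p q = t *\<^sub>R pt l1 p q1 + (1 - t) *\<^sub>R pt 0 p q2"
  proof (rule pt_mean)
    have "(t * (1 - l1)) *\<^sub>R q1 + ((1 - t) * (1 - 0)) *\<^sub>R q2 =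
        (1 - t * l1 - l1 + t * l1) *\<^sub>R q1 + (l1 - t * l1) *\<^sub>R r"
      unfolding q2_def by (simp add: algebra_simps)
    also have "\<dots> = (1 - l1) *\<^sub>R q1 + (l1 - l) *\<^sub>R r" unfolding tl by simp
    also have "\<dots> = (1 - l) *\<^sub>R q" unfolding l1d qr by (simp add: l1_def algebra_simps)
    finally show "(1 - l) *\<^sub>R q = (t * (1 - l1)) *\<^sub>R q1 + ((1 - t) * (1 - 0)) *\<^sub>R q2" by simp
  qed (auto simp: tl)
  have "pt l1 p q1 - pt 0 p q2 = l1 *\<^sub>R (pt 1 p r - pt 0 p r)"
    unfolding pt_1_minus_pt_0 unfolding pt_alt q2_def by (simp add: complex_eq_iff algebra_simps)
  moreover have "fst (pt l1 p q1 - pt 0 p q2) \<noteq> 0" using l1 l by (simp add: pt_def)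
  ultimately have cone: "pt l1 p q1 - pt 0 p q2 \<in> wave_cone A"
    using cone_form_pt[of A l1 p r] r by (intro wave_coneI) auto
  have "flux A (pt l p q) = t * flux A (pt l1 p q1) + (1 - t) * flux A (pt 0 p q2)"
    unfolding z by (intro flux_lam cone_form_wave_cone cone)
  also have "flux A (pt l1 p q1) = N"
    using p q1 by (simp add: flux_pt N_def[symmetric]) (simp add: algebra_simps)
  also have "flux A (pt 0 p q2) = excess (- A) q2" by (simp add: flux_pt)
  finally have "(1 - t) * excess (- A) q2 \<le> (1 - t) * N" using fl by (simp add: N_def algebra_simps)
  then have q2: "excess (- A) q2 \<le> N" using t by simp
  have "pt l1 p q1 \<in> lam_iter (Suc 0) (wave_cone A) (bounded_constraint_set A M)"
    using A l l1 p q1 by (intro pt_in_lam_iter_1) (auto simp: N_def)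
  moreover have "pt 0 p q2 \<in> lam_iter (Suc 0) (wave_cone A) (bounded_constraint_set A M)"
    using A p q2 by (intro pt_in_lam_iter_1) (auto simp: N_def)
  ultimately show ?thesis
    unfolding lam_iter_Suc[of "Suc 0"] using t cone z by (intro lam_stepI[of t]) auto
qed

section \<open>The symmetry exchanging the two phases\<close>

definition reflect :: "state \<Rightarrow> state" where
  "reflect = (\<lambda>(\<theta>, u, m). (- \<theta>, - u, m))"

lemma linear_reflect: "linear reflect"
  by (intro linearI) (auto simp: reflect_def)

text \<open>The phases change places and \<open>p\<close>, \<open>q\<close> change sign. Together
  with the passage from \<open>A\<close> to \<open>- A\<close> this turns the case of extremal
  \<open>q\<close> into that of extremal \<open>p\<close>.\<close>

lemma reflect_pt: "reflect (pt (1 - l) (- q) (- p)) = pt l p q"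
  unfolding reflect_def pt_def by (simp add: complex_eq_iff algebra_simps)

lemma reflect_wave_cone: "reflect ` wave_cone (- A) \<subseteq> wave_cone A"
proof
  fix z assume "z \<in> reflect ` wave_cone (- A)"
  then obtain \<theta> u m where w: "(\<theta>, u, m) \<in> wave_cone (- A)" and z: "z = (- \<theta>, - u, m)"
    by (auto simp: reflect_def)
  show "z \<in> wave_cone A"
  proof (cases "(\<theta>, u, m) \<in> wave_cone0 (- A)")
    case True
    then show ?thesis by (simp add: z wave_cone_def wave_cone0_def)
  next
    case False
    then obtain \<omega> where "\<theta> \<noteq> 0" "cmod (2 * \<omega> + 1) = 1" "u = \<omega> * ((- A) *\<^sub>R m + \<theta> *\<^sub>R \<i>)"
      using w by (auto simp: wave_cone_def wave_cone1_def)
    moreover from this have "- u = \<omega> * (A *\<^sub>R m + (- \<theta>) *\<^sub>R \<i>)" by (simp add: algebra_simps)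
    ultimately show ?thesis by (auto simp: z wave_cone_def wave_cone1_def)
  qed
qed

lemma reflect_bounded_constraint_set:
  "reflect ` bounded_constraint_set (- A) M \<subseteq> bounded_constraint_set A M"
proof
  fix z assume "z \<in> reflect ` bounded_constraint_set (- A) M"
  then obtain \<theta> u m where w: "(\<theta>, u, m) \<in> bounded_constraint_set (- A) M" and z: "z = (- \<theta>, - u, m)"
    by (auto simp: reflect_def)
  have "cmod (2 * (- u) + (- \<theta>) *\<^sub>R \<i>) = cmod (2 * u + \<theta> *\<^sub>R \<i>)"
    by (subst norm_minus_cancel[symmetric]) simp
  then show "z \<in> bounded_constraint_set A M"
    using w by (auto simp: z bounded_constraint_set_def constraint_set_def)
qed

lemma lam_iter_image:
  assumes T: "linear T" and "T ` \<Lambda> \<subseteq> \<Lambda>'" "T ` K \<subseteq> K'"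
  shows "T ` lam_iter n \<Lambda> K \<subseteq> lam_iter n \<Lambda>' K'"
proof (induction n)
  case 0
  then show ?case using assms by (simp add: lam_iter_def)
next
  case (Suc n)
  show ?case
  proof
    fix y assume "y \<in> T ` lam_iter (Suc n) \<Lambda> K"
    then obtain s z1 z2 where s: "s \<in> {-1..1}" and z: "z1 \<in> lam_iter n \<Lambda> K" "z2 \<in> lam_iter n \<Lambda> K"
      "z1 - z2 \<in> \<Lambda>" and y: "y = T (((1 + s) / 2) *\<^sub>R z1 + ((1 - s) / 2) *\<^sub>R z2)"
      unfolding lam_iter_Suc lam_step_def by blast
    have "y = ((1 + s) / 2) *\<^sub>R T z1 + ((1 - s) / 2) *\<^sub>R T z2"
      unfolding y using T by (simp add: linear_add linear_scale)
    moreover have "T z1 \<in> lam_iter n \<Lambda>' K'" "T z2 \<in> lam_iter n \<Lambda>' K'" using z Suc by auto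
    moreover have "T z1 - T z2 \<in> \<Lambda>'" using z(3) T assms(2) by (auto simp: linear_diff[symmetric])
    ultimately show "y \<in> lam_iter (Suc n) \<Lambda>' K'"
      unfolding lam_iter_Suc lam_step_def using s by blast
  qed
qed

lemma gap_reflect: "gap (- A) (- q) (- p) = gap A p q"
  by (simp add: gap_def inner_commute algebra_simps)

lemma excess_minus: "excess B (- p) = excess B p"
  by (simp add: excess_def)

lemma flux_reflect: "flux (- A) (pt (1 - l) (- q) (- p)) = flux A (pt l p q)"
  unfolding flux_pt by (simp add: gap_reflect excess_minus)

lemma boundary_pt_in_lam_iter_2:
  assumes A: "\<bar>A\<bar> < 1" and M: "1 < M" and l: "0 < l" "l < 1"
    and p: "excess A p \<le> M\<^sup>2 - 1" and q: "excess (- A) q \<le> M\<^sup>2 - 1"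
    and g: "0 \<le> gap A p q" and fl: "flux A (pt l p q) \<le> M\<^sup>2 - 1"
    and bd: "excess A p = M\<^sup>2 - 1 \<or> excess (- A) q = M\<^sup>2 - 1 \<or> gap A p q = 0"
  shows "pt l p q \<in> lam_iter (Suc (Suc 0)) (wave_cone A) (bounded_constraint_set A M)"
proof -
  consider "gap A p q = 0" | "0 < gap A p q" "excess A p = M\<^sup>2 - 1"
    | "0 < gap A p q" "excess (- A) q = M\<^sup>2 - 1" using g bd by fastforce
  then show ?thesis
  proof cases
    case 1
    then show ?thesis
      using pt_in_lam_iter_1[OF A _ _ p q, of l] l lam_iter_mono_Suc[OF zero_in_wave_cone, of "Suc 0"]
      by auto
  next
    case 2
    then show ?thesis using assms by (intro pt_in_lam_iter_2) auto
  next
    case 3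
    have "pt (1 - l) (- q) (- p) \<in>
        lam_iter (Suc (Suc 0)) (wave_cone (- A)) (bounded_constraint_set (- A) M)"
      using 3 assms by (intro pt_in_lam_iter_2) (auto simp: gap_reflect excess_minus flux_reflect)
    then have "reflect (pt (1 - l) (- q) (- p)) \<in>
        lam_iter (Suc (Suc 0)) (wave_cone A) (bounded_constraint_set A M)"
      using lam_iter_image[OF linear_reflect reflect_wave_cone reflect_bounded_constraint_set] by blast
    then show ?thesis by (simp add: reflect_pt)
  qed
qed

text \<open>The opposite shifts of the phases are weighted so that the state moves along
  \<open>wave_cone0 A\<close> with \<open>\<theta>\<close> unchanged.\<close>

lemma pt_shift:
  "pt l (p + ((1 - l) * (1 - A)) *\<^sub>R d) (q - (l * (1 + A)) *\<^sub>R d) =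
    pt l p q + (0, - (A *\<^sub>R ((l * (1 - l)) *\<^sub>R d)), (l * (1 - l)) *\<^sub>R d)"
  unfolding pt_def by (simp add: complex_eq_iff field_simps)

text \<open>The quadratic part of \<open>flux\<close> vanishes on \<open>wave_cone0 A\<close>, so
  the expansion stops at first order.\<close>

lemma flux_shift:
  "flux A ((\<theta>, u, m) + (0, - (A *\<^sub>R v), v)) =
    flux A (\<theta>, u, m) - 4 * A * (v \<bullet> (u + A *\<^sub>R m + \<theta> *\<^sub>R \<i> + A *\<^sub>R \<i>))"
  unfolding flux_def by (simp add: inner_complex_def) algebra

text \<open>Far along \<open>d\<close> the excess of the first phase is above \<open>N\<close>. The
  intermediate value theorem stops the motion where the least of the three slacks vanishes.\<close>

lemma exists_exit:
  assumes A: "\<bar>A\<bar> < 1" and l: "0 < l" "l < 1" and d: "d \<noteq> 0"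
    and p: "excess A p \<le> N" and q: "excess (- A) q \<le> N" and g: "0 \<le> gap A p q"
  obtains s p' q' where "0 \<le> s" "p' = p + ((1 - l) * (1 - A)) *\<^sub>R (s *\<^sub>R d)" "q' = q - (l * (1 + A)) *\<^sub>R (s *\<^sub>R d)"
    "excess A p' \<le> N" "excess (- A) q' \<le> N" "0 \<le> gap A p' q'"
    "excess A p' = N \<or> excess (- A) q' = N \<or> gap A p' q' = 0"
proof -
  define P Q where "P = (\<lambda>s. p + ((1 - l) * (1 - A)) *\<^sub>R (s *\<^sub>R d))"
    and "Q = (\<lambda>s. q - (l * (1 + A)) *\<^sub>R (s *\<^sub>R d))"
  define \<psi> where "\<psi> = (\<lambda>s. min (N - excess A (P s)) (min (N - excess (- A) (Q s)) (gap A (P s) (Q s))))"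
  define c R where "c = (1 - l) * (1 - A) * cmod d" and "R = sqrt (N / (1 + A) + 1)"
  have c: "0 < c" using A l d by (simp add: c_def)
  \<comment> \<open>Chosen so that \<open>S * c = \<bar>R\<bar> + cmod p + 1\<close>, whence
    \<open>cmod (P S)\<close> exceeds the radius \<open>R\<close> that bounds all points with
    \<open>excess A\<close> at most \<open>N\<close>.\<close>
  define S where "S = (\<bar>R\<bar> + cmod p + 1) / c"
  have S: "0 \<le> S" using c by (simp add: S_def)
  have "\<bar>R\<bar> + 1 = S * c - cmod p" using c by (simp add: S_def)
  also have "S * c = cmod (((1 - l) * (1 - A)) *\<^sub>R (S *\<^sub>R d))"
    using S A l by (simp add: c_def abs_mult)
  also have "\<dots> - cmod p \<le> cmod (P S)"
    unfolding P_def by (metis add.commute norm_diff_ineq)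
  finally have "R < cmod (P S)" by linarith
  then have "N < excess A (P S)" using excess_le_imp_cball[of A "P S" N] A by (force simp: R_def)
  then have "\<psi> S \<le> 0" by (simp add: \<psi>_def)
  moreover have "0 \<le> \<psi> 0" using p q g by (simp add: \<psi>_def P_def Q_def)
  moreover have "continuous_on {0..S} \<psi>"
    unfolding \<psi>_def P_def Q_def by (intro continuous_intros)
  ultimately obtain s where s: "0 \<le> s" "\<psi> s = 0"
    using IVT2'[of \<psi> S 0 0] S by auto
  then have "excess A (P s) \<le> N" "excess (- A) (Q s) \<le> N" "0 \<le> gap A (P s) (Q s)"
    "excess A (P s) = N \<or> excess (- A) (Q s) = N \<or> gap A (P s) (Q s) = 0"
    unfolding \<psi>_def by (auto simp: min_def split: if_splits)
  then show ?thesis using that[OF s(1) refl refl] unfolding P_def Q_def by blast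
qed

lemma exists_orthogonal: "\<exists>d::complex. d \<noteq> 0 \<and> d \<bullet> v = 0"
proof (cases "v = 0")
  case True
  then show ?thesis by (intro exI[of _ 1]) simp
next
  case False
  then show ?thesis by (intro exI[of _ "\<i> * v"]) (simp add: inner_complex_def)
qed

lemma pt_in_lam_iter_3:
  assumes A: "\<bar>A\<bar> < 1" and M: "1 < M" and l: "0 < l" "l < 1"
    and p: "excess A p \<le> M\<^sup>2 - 1" and q: "excess (- A) q \<le> M\<^sup>2 - 1"
    and g: "0 \<le> gap A p q" and fl: "flux A (pt l p q) \<le> M\<^sup>2 - 1"
  shows "pt l p q \<in> lam_iter (Suc (Suc (Suc 0))) (wave_cone A) (bounded_constraint_set A M)"
proof -
  obtain \<theta> u m where z: "pt l p q = (\<theta>, u, m)" by (metis prod_cases3)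
  \<comment> \<open>By \<open>flux_shift\<close> this orthogonality keeps the flux constant along
    the segment.\<close>
  obtain d where d: "d \<noteq> 0" "d \<bullet> (u + A *\<^sub>R m + \<theta> *\<^sub>R \<i> + A *\<^sub>R \<i>) = 0"
    using exists_orthogonal by blast
  define w where "w = (\<lambda>s. (0::real, - (A *\<^sub>R ((l * (1 - l)) *\<^sub>R (s *\<^sub>R d))), (l * (1 - l)) *\<^sub>R (s *\<^sub>R d)))"
  have fw: "flux A (pt l p q + w s) = flux A (pt l p q)" for s
    unfolding z w_def flux_shift using d(2) by simp
  obtain s p1 q1 where s: "0 \<le> s" and 1: "p1 = p + ((1 - l) * (1 - A)) *\<^sub>R (s *\<^sub>R d)" "q1 = q - (l * (1 + A)) *\<^sub>R (s *\<^sub>R d)"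
    "excess A p1 \<le> M\<^sup>2 - 1" "excess (- A) q1 \<le> M\<^sup>2 - 1" "0 \<le> gap A p1 q1"
    "excess A p1 = M\<^sup>2 - 1 \<or> excess (- A) q1 = M\<^sup>2 - 1 \<or> gap A p1 q1 = 0"
    using exists_exit[OF A l d(1) p q g] by blast
  \<comment> \<open>The exit in the opposite direction.\<close>
  obtain r p2 q2 where r: "0 \<le> r" and 2: "p2 = p + ((1 - l) * (1 - A)) *\<^sub>R (r *\<^sub>R - d)" "q2 = q - (l * (1 + A)) *\<^sub>R (r *\<^sub>R - d)"
    "excess A p2 \<le> M\<^sup>2 - 1" "excess (- A) q2 \<le> M\<^sup>2 - 1" "0 \<le> gap A p2 q2"
    "excess A p2 = M\<^sup>2 - 1 \<or> excess (- A) q2 = M\<^sup>2 - 1 \<or> gap A p2 q2 = 0"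
    using exists_exit[OF A l _ p q g, of "- d"] d(1) by (metis neg_equal_0_iff_equal)
  have z1: "pt l p1 q1 = pt l p q + w s" unfolding 1(1,2) pt_shift w_def ..
  have z2: "pt l p2 q2 = pt l p q + w (- r)" unfolding 2(1,2) pt_shift w_def by simp
  have L1: "pt l p1 q1 \<in> lam_iter (Suc (Suc 0)) (wave_cone A) (bounded_constraint_set A M)"
    using 1 fl fw z1 by (intro boundary_pt_in_lam_iter_2 A M l) auto
  have L2: "pt l p2 q2 \<in> lam_iter (Suc (Suc 0)) (wave_cone A) (bounded_constraint_set A M)"
    using 2 fl fw z2 by (intro boundary_pt_in_lam_iter_2 A M l) auto
  have wdiff: "w s - w (- r) \<in> wave_cone A"
    unfolding wave_cone_def wave_cone0_def w_def by (simp add: algebra_simps)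
  show ?thesis
  proof (cases "s + r = 0")
    case True
    then have "s = 0" using s r by simp
    then have "pt l p q = pt l p1 q1" using 1(1,2) by simp
    then show ?thesis
      using L1 lam_iter_mono_Suc[OF zero_in_wave_cone, of "Suc (Suc 0)"] by auto
  next
    case False
    define t where "t = r / (s + r)"
    have t: "0 \<le> t" "t \<le> 1" using s r False by (auto simp: t_def field_simps)
    have "t * (s + r) = r" using False by (simp add: t_def)
    then have "t * s + (1 - t) * (- r) = 0" by (simp add: algebra_simps)
    moreover have "t *\<^sub>R w s + (1 - t) *\<^sub>R w (- r) = w (t * s + (1 - t) * (- r))"
      unfolding w_def by (simp add: complex_eq_iff algebra_simps)
    ultimately have "t *\<^sub>R w s + (1 - t) *\<^sub>R w (- r) = w 0" by simp
    also have "w 0 = 0" by (simp add: w_def zero_prod_def)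
    finally have "pt l p q = t *\<^sub>R pt l p1 q1 + (1 - t) *\<^sub>R pt l p2 q2"
      unfolding z1 z2 by (simp add: algebra_simps)
    moreover have "pt l p1 q1 - pt l p2 q2 \<in> wave_cone A" unfolding z1 z2 using wdiff by simp
    ultimately show ?thesis
      unfolding lam_iter_Suc[of "Suc (Suc 0)"] using t L1 L2 by (intro lam_stepI[of t]) auto
  qed
qed

lemma hull_closed_subset_lam_hull:
  assumes A: "\<bar>A\<bar> < 1" and M: "1 < M"
  shows "hull_closed A (M\<^sup>2 - 1) \<subseteq> lam_hull (wave_cone A) (bounded_constraint_set A M)"
proof
  fix z assume "z \<in> hull_closed A (M\<^sup>2 - 1)"
  then obtain l p q where z: "z = pt l p q" "0 \<le> l" "l \<le> 1" "excess A p \<le> M\<^sup>2 - 1" "excess (- A) q \<le> M\<^sup>2 - 1"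
    "0 \<le> l * (1 - l) * gap A p q" "flux A (pt l p q) \<le> M\<^sup>2 - 1" unfolding hull_closed_def by blast
  have "\<exists>n. z \<in> lam_iter (Suc n) (wave_cone A) (bounded_constraint_set A M)"
  proof (cases "l * (1 - l) = 0")
    case True
    then show ?thesis using pt_in_lam_iter_1[OF A z(2-5)] z(1) by auto
  next
    case False
    then have "0 < l" "l < 1" using z(2,3) by auto
    moreover from this have "0 < l * (1 - l)" by simp
    then have "0 \<le> gap A p q" using z(6) by (metis mult_less_0_iff not_le)
    ultimately show ?thesis using pt_in_lam_iter_3[OF A M] z by blast
  qed
  then show "z \<in> lam_hull (wave_cone A) (bounded_constraint_set A M)"
    unfolding lam_hull_def by force
qed

section \<open>Density of the open hull\<close>

lemma continuous_on_at_right: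
  fixes f :: "real \<Rightarrow> 'a::topological_space"
  shows "continuous_on UNIV f \<Longrightarrow> (f \<longlongrightarrow> f 0) (at_right 0)"
  by (auto simp: continuous_on_def intro: tendsto_mono[OF at_le])

text \<open>The path only has to run in the closure, so the approximations below can be chained,
  each removing one degeneracy.\<close>

lemma in_closure_of_path:
  assumes "continuous_on UNIV \<gamma>" "eventually (\<lambda>t. \<gamma> t \<in> closure S) (at_right (0::real))" "\<gamma> 0 = z"
  shows "z \<in> closure S"
  using Lim_in_closed_set[OF closed_closure assms(2) _ continuous_on_at_right[OF assms(1)]] assms(3) by simp

lemma eventually_at_right_0_less: "0 < e \<Longrightarrow> eventually (\<lambda>t. 0 < t \<and> t < e) (at_right (0::real))"
  using eventually_at_right[of 0 e] by auto

lemma excess_segment_less: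
  assumes "- 1 < B" "excess B p \<le> N" "excess B x \<le> 0" "0 < N" "0 < t" "t < 1"
  shows "excess B ((1 - t) *\<^sub>R p + t *\<^sub>R x) < N"
proof -
  obtain z where z: "((1 - t) + t) *\<^sub>R z = (1 - t) *\<^sub>R p + t *\<^sub>R x"
    "((1 - t) + t) * excess B z \<le> (1 - t) * excess B p + t * excess B x"
    using excess_mean[of B "1 - t" t p N x] assms by auto
  have "(1 - t) * excess B p + t * excess B x \<le> (1 - t) * N + t * 0"
    using assms by (intro add_mono mult_left_mono) auto
  also have "\<dots> < N" using assms by (simp add: algebra_simps)
  finally show ?thesis using z by simp
qed

text \<open>Completing the square in \<open>D\<close>, half of the first vector in
  \<open>gap_factor\<close>.\<close>

lemma gap_sum_diff:
  "gap A (2 * S + D + \<i>) (2 * S - D - \<i>) = 4 * ((cmod (A *\<^sub>R S + \<i>))\<^sup>2 - (cmod (D + (A *\<^sub>R S + \<i>)))\<^sup>2)"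
  unfolding gap_def cmod_power2 by (simp add: inner_complex_def) algebra

lemma sum_diff_split:
  fixes p q :: complex
  obtains S D where "p = 2 * S + D + \<i>" "q = 2 * S - D - \<i>"
  using that[of "(p + q) / 4" "(p - q) / 2 - \<i>"] by (simp add: field_simps)

context
  fixes A M :: real
  assumes A: "\<bar>A\<bar> < 1" and M: "1 < M"
begin

text \<open>Shrinking \<open>p\<close> and \<open>q\<close> towards 0, where the excess is negative,
  makes both excess bounds strict; the strict conditions on gap and flux persist for small
  \<open>t\<close>.\<close>

lemma closure_strict_flux:
  assumes l: "0 < l" "l < 1" and p: "excess A p \<le> M\<^sup>2 - 1" and q: "excess (- A) q \<le> M\<^sup>2 - 1"
    and g: "0 < gap A p q" and fl: "flux A (pt l p q) < M\<^sup>2 - 1"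
  shows "pt l p q \<in> closure (hull_interior A M)"
proof (rule in_closure_of_path)
  \<comment> \<open>The zero summand is kept to match \<open>excess_segment_less\<close>.\<close>
  let ?p = "\<lambda>t. (1 - t) *\<^sub>R p + t *\<^sub>R 0" and ?q = "\<lambda>t. (1 - t) *\<^sub>R q + t *\<^sub>R 0"
  show "continuous_on UNIV (\<lambda>t. pt l (?p t) (?q t))" by (intro continuous_intros)
  have "((\<lambda>t. gap A (?p t) (?q t)) \<longlongrightarrow> gap A (?p 0) (?q 0)) (at_right 0)"
    by (intro continuous_on_at_right continuous_intros)
  then have 1: "eventually (\<lambda>t. 0 < gap A (?p t) (?q t)) (at_right 0)"
    using g by (intro order_tendstoD(1)) auto
  have "((\<lambda>t. flux A (pt l (?p t) (?q t))) \<longlongrightarrow> flux A (pt l (?p 0) (?q 0))) (at_right 0)"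
    unfolding flux_pt by (intro continuous_on_at_right continuous_intros)
  then have 2: "eventually (\<lambda>t. flux A (pt l (?p t) (?q t)) < M\<^sup>2 - 1) (at_right 0)"
    using fl by (intro order_tendstoD(2)) auto
  have "eventually (\<lambda>t. 0 < t \<and> t < (1::real)) (at_right 0)" by (rule eventually_at_right_0_less) simp
  with 1 2 show "eventually (\<lambda>t. pt l (?p t) (?q t) \<in> closure (hull_interior A M)) (at_right 0)"
  proof eventually_elim
    case (elim t)
    have "excess A (?p t) < M\<^sup>2 - 1"
      using A p square_minus_1_pos[OF M] elim by (intro excess_segment_less) (auto simp: excess_def)
    moreover have "excess (- A) (?q t) < M\<^sup>2 - 1"
      using A q square_minus_1_pos[OF M] elim by (intro excess_segment_less) (auto simp: excess_def)
    ultimately have "pt l (?p t) (?q t) \<in> hull_interior A M"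
      using elim l A by (simp only: pt_in_hull_interior_iff)
    then show ?case using closure_subset by blast
  qed
qed simp

text \<open>For fixed phases with positive gap the flux is strictly concave in \<open>l\<close>, so
  moving \<open>l\<close> in a direction of nonpositive slope makes the flux bound strict.\<close>

lemma closure_gap_pos:
  assumes l: "0 < l" "l < 1" and p: "excess A p \<le> M\<^sup>2 - 1" and q: "excess (- A) q \<le> M\<^sup>2 - 1"
    and g: "0 < gap A p q" and fl: "flux A (pt l p q) \<le> M\<^sup>2 - 1"
  shows "pt l p q \<in> closure (hull_interior A M)"
proof -
  \<comment> \<open>The derivative of the flux in \<open>l\<close>, and a direction in which it is
    not positive.\<close>
  define e \<epsilon> where "e = excess A p - excess (- A) q + (1 - 2 * l) * gap A p q"
    and "\<epsilon> = (if 0 \<le> e then - 1 else 1 :: real)"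
  have "\<epsilon> * e \<le> 0" by (simp add: \<epsilon>_def)
  show ?thesis
  proof (rule in_closure_of_path)
    show "continuous_on UNIV (\<lambda>t. pt (l + \<epsilon> * t) p q)" by (intro continuous_intros)
    have "eventually (\<lambda>t. 0 < t \<and> t < min l (1 - l)) (at_right 0)"
      using l by (intro eventually_at_right_0_less) simp
    then show "eventually (\<lambda>t. pt (l + \<epsilon> * t) p q \<in> closure (hull_interior A M)) (at_right 0)"
    proof eventually_elim
      case (elim t)
      have "flux A (pt (l + \<epsilon> * t) p q) = flux A (pt l p q) + t * (\<epsilon> * e) - (\<epsilon> * t)\<^sup>2 * gap A p q"
        unfolding flux_pt e_def by algebra
      moreover have "t * (\<epsilon> * e) \<le> 0" using elim \<open>\<epsilon> * e \<le> 0\<close> by (simp add: mult_nonneg_nonpos)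
      moreover have "0 < (\<epsilon> * t)\<^sup>2 * gap A p q" using g elim by (simp add: \<epsilon>_def)
      ultimately have "flux A (pt (l + \<epsilon> * t) p q) < M\<^sup>2 - 1" using fl by linarith
      moreover have "0 < l + \<epsilon> * t" "l + \<epsilon> * t < 1" using elim by (auto simp: \<epsilon>_def)
      ultimately show ?case using p q g by (intro closure_strict_flux)
    qed
  qed simp
qed

text \<open>
  In the variables \<open>S\<close>, \<open>D\<close> the condition \<open>gap \<ge> 0\<close> says that \<open>D\<close> lies in the disc with centre
  \<open>- (A S + \<i>)\<close> through \<open>0\<close>; moving \<open>D\<close> towards the centre makes the gap positive.
\<close>

lemma closure_gap_zero_strict:
  assumes l: "0 < l" "l < 1" and p: "excess A (2 * S + D + \<i>) < M\<^sup>2 - 1"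
    and q: "excess (- A) (2 * S - D - \<i>) < M\<^sup>2 - 1"
    and g: "gap A (2 * S + D + \<i>) (2 * S - D - \<i>) = 0" and W: "A *\<^sub>R S + \<i> \<noteq> 0"
  shows "pt l (2 * S + D + \<i>) (2 * S - D - \<i>) \<in> closure (hull_interior A M)"
proof (rule in_closure_of_path)
  define W where "W = A *\<^sub>R S + \<i>"
  let ?D = "\<lambda>t. D - t *\<^sub>R (D + W)"
  let ?p = "\<lambda>t. 2 * S + ?D t + \<i>" and ?q = "\<lambda>t. 2 * S - ?D t - \<i>"
  show "continuous_on UNIV (\<lambda>t. pt l (?p t) (?q t))" by (intro continuous_intros)
  have DW: "(cmod (D + W))\<^sup>2 = (cmod W)\<^sup>2" using g unfolding gap_sum_diff W_def by simp
  have "((\<lambda>t. excess A (?p t)) \<longlongrightarrow> excess A (?p 0)) (at_right 0)"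
    by (intro continuous_on_at_right continuous_intros)
  then have 1: "eventually (\<lambda>t. excess A (?p t) < M\<^sup>2 - 1) (at_right 0)"
    using p by (intro order_tendstoD(2)) auto
  have "((\<lambda>t. excess (- A) (?q t)) \<longlongrightarrow> excess (- A) (?q 0)) (at_right 0)"
    by (intro continuous_on_at_right continuous_intros)
  then have 2: "eventually (\<lambda>t. excess (- A) (?q t) < M\<^sup>2 - 1) (at_right 0)"
    using q by (intro order_tendstoD(2)) auto
  have "flux A (pt l (?p 0) (?q 0)) < l * (M\<^sup>2 - 1) + (1 - l) * (M\<^sup>2 - 1)"
    using p q g l unfolding flux_pt by (simp add: add_strict_mono)
  then have fl: "flux A (pt l (?p 0) (?q 0)) < M\<^sup>2 - 1" by (simp add: algebra_simps)
  have "((\<lambda>t. flux A (pt l (?p t) (?q t))) \<longlongrightarrow> flux A (pt l (?p 0) (?q 0))) (at_right 0)"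
    unfolding flux_pt by (intro continuous_on_at_right continuous_intros)
  then have 3: "eventually (\<lambda>t. flux A (pt l (?p t) (?q t)) < M\<^sup>2 - 1) (at_right 0)"
    using fl by (intro order_tendstoD(2)) auto
  have "eventually (\<lambda>t. 0 < t \<and> t < (1::real)) (at_right 0)" by (rule eventually_at_right_0_less) simp
  with 1 2 3 show "eventually (\<lambda>t. pt l (?p t) (?q t) \<in> closure (hull_interior A M)) (at_right 0)"
  proof eventually_elim
    case (elim t)
    have "?D t + W = (1 - t) *\<^sub>R (D + W)" by (simp add: algebra_simps)
    then have "(cmod (?D t + W))\<^sup>2 = (1 - t)\<^sup>2 * (cmod W)\<^sup>2"
      using DW by (simp add: power_mult_distrib)
    then have "gap A (?p t) (?q t) = 4 * (1 - (1 - t)\<^sup>2) * (cmod W)\<^sup>2"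
      unfolding gap_sum_diff W_def[symmetric] by (simp add: algebra_simps)
    also have "0 < \<dots>"
    proof -
      have "1 - (1 - t)\<^sup>2 = t * (2 - t)" by (simp add: power2_eq_square algebra_simps)
      then show ?thesis using elim W by (simp add: W_def)
    qed
    finally show ?case using elim l by (intro closure_strict_flux) auto
  qed
qed simp

text \<open>When \<open>A *\<^sub>R S + \<i> = 0\<close> the disc for \<open>D\<close> is a single
  point and has no interior. A real shift of \<open>S\<close> with \<open>D = 0\<close> restores a
  positive radius and keeps the gap zero.\<close>

lemma closure_gap_zero:
  assumes l: "0 < l" "l < 1" and p: "excess A p < M\<^sup>2 - 1" and q: "excess (- A) q < M\<^sup>2 - 1"
    and g: "gap A p q = 0"
  shows "pt l p q \<in> closure (hull_interior A M)"
proof -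
  obtain S D where pq: "p = 2 * S + D + \<i>" "q = 2 * S - D - \<i>" by (rule sum_diff_split)
  show ?thesis
  proof (cases "A *\<^sub>R S + \<i> = 0")
    case False
    then show ?thesis using assms unfolding pq by (intro closure_gap_zero_strict)
  next
    case True
    then have "A \<noteq> 0" by auto
    have D: "D = 0" using g True unfolding pq gap_sum_diff by simp
    let ?S = "\<lambda>t. S + of_real t"
    let ?p = "\<lambda>t. 2 * ?S t + D + \<i>" and ?q = "\<lambda>t. 2 * ?S t - D - \<i>"
    show ?thesis unfolding pq
    proof (rule in_closure_of_path)
      show "continuous_on UNIV (\<lambda>t. pt l (?p t) (?q t))" by (intro continuous_intros)
      have "((\<lambda>t. excess A (?p t)) \<longlongrightarrow> excess A (?p 0)) (at_right 0)"
        by (intro continuous_on_at_right continuous_intros)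
      then have 1: "eventually (\<lambda>t. excess A (?p t) < M\<^sup>2 - 1) (at_right 0)"
        using p pq by (intro order_tendstoD(2)) auto
      have "((\<lambda>t. excess (- A) (?q t)) \<longlongrightarrow> excess (- A) (?q 0)) (at_right 0)"
        by (intro continuous_on_at_right continuous_intros)
      then have 2: "eventually (\<lambda>t. excess (- A) (?q t) < M\<^sup>2 - 1) (at_right 0)"
        using q pq by (intro order_tendstoD(2)) auto
      have "eventually (\<lambda>t. 0 < t \<and> t < (1::real)) (at_right 0)" by (rule eventually_at_right_0_less) simp
      with 1 2 show "eventually (\<lambda>t. pt l (?p t) (?q t) \<in> closure (hull_interior A M)) (at_right 0)"
      proof eventually_elim
        case (elim t)
        have "A *\<^sub>R ?S t + \<i> = (A *\<^sub>R S + \<i>) + of_real (A * t)"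
          by (simp add: scaleR_conv_of_real algebra_simps)
        also have "\<dots> = of_real (A * t)" using True by simp
        finally have "A *\<^sub>R ?S t + \<i> \<noteq> 0" using elim \<open>A \<noteq> 0\<close> by simp
        moreover have "gap A (?p t) (?q t) = 0" unfolding gap_sum_diff D by simp
        ultimately show ?case using elim l by (intro closure_gap_zero_strict) auto
      qed
    qed simp
  qed
qed

text \<open>
  For \<open>\<bar>2\<omega> + 1\<bar> = 1\<close> the pairs with \<open>D = 2\<omega>(A S + \<i>)\<close> form an affine family inside \<open>gap = 0\<close>. It
  contains \<open>(x, - x)\<close> with \<open>x = \<i>(2\<omega> + 1)\<close>, where both excesses vanish and so are below \<open>M\<^sup>2 - 1\<close>.
\<close>

lemma closure_gap_zero_le:
  assumes l: "0 < l" "l < 1" and p: "excess A p \<le> M\<^sup>2 - 1" and q: "excess (- A) q \<le> M\<^sup>2 - 1"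
    and g: "gap A p q = 0"
  shows "pt l p q \<in> closure (hull_interior A M)"
proof -
  obtain S D where pq: "p = 2 * S + D + \<i>" "q = 2 * S - D - \<i>" by (rule sum_diff_split)
  define W where "W = A *\<^sub>R S + \<i>"
  have "D \<bullet> (D + 2 * W) = 0"
    using g unfolding pq gap_sum_diff W_def[symmetric] cmod_power2
    by (simp add: inner_complex_def power2_eq_square algebra_simps)
  then obtain \<omega> where \<omega>: "cmod (2 * \<omega> + 1) = 1" "D = \<omega> * (2 * W)" by (rule cone_form_zeroE)
  define x where "x = \<i> * (2 * \<omega> + 1)"
  have x: "cmod x = 1" using \<omega>(1) by (simp add: x_def norm_mult)
  let ?p = "\<lambda>t. (1 - t) *\<^sub>R p + t *\<^sub>R x" and ?q = "\<lambda>t. (1 - t) *\<^sub>R q + t *\<^sub>R (- x)"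
  show ?thesis
  proof (rule in_closure_of_path)
    show "continuous_on UNIV (\<lambda>t. pt l (?p t) (?q t))" by (intro continuous_intros)
    have "eventually (\<lambda>t. 0 < t \<and> t < (1::real)) (at_right 0)" by (rule eventually_at_right_0_less) simp
    then show "eventually (\<lambda>t. pt l (?p t) (?q t) \<in> closure (hull_interior A M)) (at_right 0)"
    proof eventually_elim
      case (elim t)
      \<comment> \<open>Since \<open>p + q = 4 * S\<close> and the pair \<open>(x, - x)\<close> has
        sum zero, the mixed pair has this \<open>S'\<close>.\<close>
      define S' where "S' = (1 - t) *\<^sub>R S"
      define W' where "W' = A *\<^sub>R S' + \<i>"
      have p': "?p t = 2 * S' + \<omega> * (2 * W') + \<i>"
        unfolding pq \<omega>(2) W'_def S'_def W_def x_def by (simp add: complex_eq_iff algebra_simps)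
      have q': "?q t = 2 * S' - \<omega> * (2 * W') - \<i>"
        unfolding pq \<omega>(2) W'_def S'_def W_def x_def by (simp add: complex_eq_iff algebra_simps)
      have "(\<omega> * (2 * W')) \<bullet> (\<omega> * (2 * W') + 2 * W') = 0" using \<omega>(1) by (rule inner_disc_boundary)
      then have "gap A (?p t) (?q t) = 0"
        unfolding p' q' gap_sum_diff W'_def[symmetric] cmod_power2
        by (simp add: inner_complex_def power2_eq_square algebra_simps)
      moreover have "excess A (?p t) < M\<^sup>2 - 1"
        using A p square_minus_1_pos[OF M] elim x by (intro excess_segment_less) (auto simp: excess_def)
      moreover have "excess (- A) (?q t) < M\<^sup>2 - 1"
        using A q square_minus_1_pos[OF M] elim x by (intro excess_segment_less) (auto simp: excess_def)
      ultimately show ?case using l by (intro closure_gap_zero)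
    qed
  qed simp
qed

lemma closure_inner:
  assumes l: "0 < l" "l < 1" and p: "excess A p \<le> M\<^sup>2 - 1" and q: "excess (- A) q \<le> M\<^sup>2 - 1"
    and g: "0 \<le> gap A p q" and fl: "flux A (pt l p q) \<le> M\<^sup>2 - 1"
  shows "pt l p q \<in> closure (hull_interior A M)"
  using closure_gap_pos[OF l p q] closure_gap_zero_le[OF l p q] g fl by (cases "gap A p q = 0") auto

end

text \<open>A state with \<open>\<theta> = 1\<close> does not determine \<open>q\<close>, so one is
  chosen that lets the state be approached from inside. For \<open>cmod p \<ge> 1\<close> the
  partner of zero gap keeps the flux equal to \<open>excess A p\<close>; for smaller
  \<open>p\<close> the choice \<open>- p\<close> has positive gap and the flux starts below
  \<open>N\<close>.\<close>

lemma endpoint_partner: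
  assumes A: "\<bar>A\<bar> < 1" and p: "excess A p \<le> N" and N: "0 < N"
  obtains q where "excess (- A) q \<le> N" "0 \<le> gap A p q"
    "eventually (\<lambda>t. flux A (pt (1 - t) p q) \<le> N) (at_right 0)"
proof (cases "1 \<le> cmod p")
  case True
  then obtain q where q: "excess (- A) q = excess A p" "gap A p q = 0" using gap_partner[OF A] by blast
  have "flux A (pt (1 - t) p q) \<le> N" for t using p q by (simp add: flux_pt algebra_simps)
  then show ?thesis using that[of q] p q by simp
next
  case False
  then have p1: "(cmod p)\<^sup>2 < 1" by (simp add: power_less_one_iff)
  have "excess (- A) (- p) \<le> 0" using p1 A unfolding excess_def by (intro mult_nonneg_nonpos) auto
  moreover have "gap A p (- p) = 4 * (1 - (cmod p)\<^sup>2)"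
    unfolding gap_def by (simp add: power2_norm_eq_inner algebra_simps)
  moreover have "((\<lambda>t. flux A (pt (1 - t) p (- p))) \<longlongrightarrow> flux A (pt (1 - 0) p (- p))) (at_right 0)"
    unfolding flux_pt by (intro continuous_on_at_right continuous_intros)
  then have "eventually (\<lambda>t. flux A (pt (1 - t) p (- p)) < N) (at_right 0)"
  proof (rule order_tendstoD(2))
    have "excess A p \<le> 0" using p1 A unfolding excess_def by (intro mult_nonneg_nonpos) auto
    then show "flux A (pt (1 - 0) p (- p)) < N" using N by (simp add: flux_pt)
  qed
  then have "eventually (\<lambda>t. flux A (pt (1 - t) p (- p)) \<le> N) (at_right 0)"
    by (rule eventually_mono) simp
  ultimately show ?thesis using that[of "- p"] p1 N by simp
qed

lemma hull_closed_subset_closure: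
  assumes A: "\<bar>A\<bar> < 1" and M: "1 < M"
  shows "hull_closed A (M\<^sup>2 - 1) \<subseteq> closure (hull_interior A M)"
proof
  fix z assume "z \<in> hull_closed A (M\<^sup>2 - 1)"
  then obtain l p q where z: "z = pt l p q" "0 \<le> l" "l \<le> 1" and p: "excess A p \<le> M\<^sup>2 - 1" and q: "excess (- A) q \<le> M\<^sup>2 - 1"
    and g: "0 \<le> l * (1 - l) * gap A p q" and fl: "flux A (pt l p q) \<le> M\<^sup>2 - 1" unfolding hull_closed_def by blast
  have ev: "eventually (\<lambda>t. 0 < t \<and> t < (1::real)) (at_right 0)" by (rule eventually_at_right_0_less) simp
  consider "l = 1" | "l = 0" | "0 < l" "l < 1" using z by linarith
  then show "z \<in> closure (hull_interior A M)"
  proof cases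
    case 1
    obtain q' where q': "excess (- A) q' \<le> M\<^sup>2 - 1" "0 \<le> gap A p q'"
      "eventually (\<lambda>t. flux A (pt (1 - t) p q') \<le> M\<^sup>2 - 1) (at_right 0)"
      using endpoint_partner[OF A p square_minus_1_pos[OF M]] by blast
    show ?thesis
    proof (rule in_closure_of_path)
      show "continuous_on UNIV (\<lambda>t. pt (1 - t) p q')" by (intro continuous_intros)
      show "eventually (\<lambda>t. pt (1 - t) p q' \<in> closure (hull_interior A M)) (at_right 0)"
        using q'(3) ev by eventually_elim (use p q' in \<open>intro closure_inner A M; simp\<close>)
    qed (simp add: z 1 pt_def)
  next
    case 2
    \<comment> \<open>The case \<open>l = 0\<close> is the reflected case \<open>l = 1\<close>, with
      \<open>- A\<close> and \<open>- q\<close>.\<close>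
    have A': "\<bar>- A\<bar> < 1" using A by simp
    have q1: "excess (- A) (- q) \<le> M\<^sup>2 - 1" using q by (simp add: excess_minus)
    obtain p' where p': "excess (- (- A)) p' \<le> M\<^sup>2 - 1" "0 \<le> gap (- A) (- q) p'"
      "eventually (\<lambda>t. flux (- A) (pt (1 - t) (- q) p') \<le> M\<^sup>2 - 1) (at_right 0)"
      using endpoint_partner[OF A' q1 square_minus_1_pos[OF M]] by blast
    show ?thesis
    proof (rule in_closure_of_path)
      show "continuous_on UNIV (\<lambda>t. pt t (- p') q)" by (intro continuous_intros)
      show "eventually (\<lambda>t. pt t (- p') q \<in> closure (hull_interior A M)) (at_right 0)"
        using p'(3) ev
      proof eventually_elim
        case (elim t)
        then show ?case
          using p' q gap_reflect[of A q "- p'"] flux_reflect[of A t q "- p'"]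
          by (intro closure_inner A M) (auto simp: excess_minus)
      qed
    qed (simp add: z 2 pt_def)
  next
    case 3
    then have "0 < l * (1 - l)" by simp
    then have "0 \<le> gap A p q" using g by (metis mult_less_0_iff not_le)
    then show ?thesis using 3 p q fl unfolding z by (intro closure_inner A M)
  qed
qed

section \<open>The closed hull as a closure, and the constraint set inside it\<close>

lemma closure_hull_interior:
  assumes A: "\<bar>A\<bar> < 1" and M: "1 < M"
  shows "closure (hull_interior A M) = hull_closed A (M\<^sup>2 - 1)"
proof (intro equalityI hull_closed_subset_closure closure_minimal A M)
  show "closed (hull_closed A (M\<^sup>2 - 1))" using compact_hull_closed[OF A] by (rule compact_imp_closed)
  show "hull_interior A M \<subseteq> hull_closed A (M\<^sup>2 - 1)"
  proof
    fix z assume z: "z \<in> hull_interior A M"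
    then obtain l p q where l: "0 < l" "l < 1" "z = pt l p q"
      using state_eq_pt hull_interior_fst by metis
    then show "z \<in> hull_closed A (M\<^sup>2 - 1)"
      using z pt_in_hull_interior_iff[OF A l(1,2), of p q M] unfolding hull_closed_def by force
  qed
qed

lemma bounded_constraint_set_subset:
  assumes A: "\<bar>A\<bar> < 1" and M: "1 < M"
  shows "bounded_constraint_set A M \<subseteq> hull_closed A (M\<^sup>2 - 1)"
proof
  fix z assume "z \<in> bounded_constraint_set A M"
  then obtain \<theta> u where z: "z = (\<theta>, u, \<theta> *\<^sub>R u)" and th: "\<theta> = 1 \<or> \<theta> = - 1"
    and b: "cmod (2 * u + \<theta> *\<^sub>R \<i>) \<le> bound_const M (\<theta> * A)"
    by (auto simp: bounded_constraint_set_def constraint_set_def abs_if split: if_splits)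
  \<comment> \<open>The phase absent from a state receives the value 0, whose excess is
    \<open>- (1 + B)\<close>.\<close>
  have 0: "excess B 0 \<le> M\<^sup>2 - 1" if "- 1 < B" for B using square_minus_1_pos[OF M] that by (simp add: excess_def)
  from th show "z \<in> hull_closed A (M\<^sup>2 - 1)"
  proof
    assume th: "\<theta> = 1"
    have "z = pt 1 (2 * u + \<i>) 0" by (simp add: z th pt_def complex_eq_iff)
    moreover have "excess A (2 * u + \<i>) \<le> M\<^sup>2 - 1" using b A by (simp add: th excess_le_iff)
    ultimately show ?thesis
      unfolding hull_closed_def using 0[of "- A"] A
      by (intro CollectI exI[of _ 1] exI[of _ "2 * u + \<i>"] exI[of _ 0]) (auto simp: flux_pt)
  next
    assume th: "\<theta> = - 1"
    have "z = pt 0 0 (2 * u - \<i>)" by (simp add: z th pt_def complex_eq_iff)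
    moreover have "excess (- A) (2 * u - \<i>) \<le> M\<^sup>2 - 1" using b A by (simp add: th excess_le_iff)
    ultimately show ?thesis
      unfolding hull_closed_def using 0[of A] A
      by (intro CollectI exI[of _ 0] exI[of _ "2 * u - \<i>"]) (auto simp: flux_pt)
  qed
qed

theorem proposition4p2:
  fixes A M :: real
  assumes "\<bar>A\<bar> < 1" and "M > 1"
  shows "lam_hull (wave_cone A) (bounded_constraint_set A M) = closure (hull_interior A M)"
  unfolding closure_hull_interior[OF assms]
  using assms
  by (intro equalityI lam_hull_subset bounded_constraint_set_subset lam_step_hull_closed
      hull_closed_subset_lam_hull)

end
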